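(* Let $f\in\mathcal{B}$ be a function for which $f^n|_{S(f)}\to\infty$ uniformly, i.e. $\lim_{n\to\infty}\inf_{s\in S(f)}|f^n(s)|=\infty$. Let $A\subset\mathbb{C}$ be a closed set with $S(f)\cup f(A)\subset A$ such that all connected components of $A$ are unbounded. Suppose that there exist $\varepsilon>0$ and $c\in(0,1)$ with the following property: if $z\in A$ is sufficiently large (i.e. $|z|\ge R$ for some constant $R$) and $w\in\mathbb{C}$ satisfies $|w-z|<c|z|$, then $\operatorname{dist}(f(w),S(f))>\varepsilon$. Then $f$ has no wandering domains.
   Context: For a transcendental entire function $f:\mathbb{C}\to\mathbb{C}$, the set $S(f)$ of (finite) singular values is the smallest closed subset of $\mathbb{C}$ such that $f:\mathbb{C}\setminus f^{-1}(S(f))\to\mathbb{C}\setminus S(f)$ is a covering map. $\mathcal{B}$ denotes the class of transcendental entire functions $f$ for which $S(f)$ is bounded. $f^n$ denotes the $n$-th iterate. The Fatou set $\mathcal{F}(f)$ is the set of points having a neighbourhood on which the family $(f^n)$ is equicontinuous with respect to the spherical metric. A wandering domain of $f$ is a connected component $W$ of $\mathcal{F}(f)$ such that $f^n(W)\cap f^m(W)=\emptyset$ whenever $n\neq m$. $\operatorname{dist}$ denotes Euclidean distance. *)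

theory Defs
  imports "HOL-Analysis.Analysis" "HOL-Computational_Algebra.Polynomial"
begin

definition transcendental_entire :: "(complex \<Rightarrow> complex) \<Rightarrow> bool" where
  "transcendental_entire f \<longleftrightarrow>
     f holomorphic_on UNIV \<and> \<not> (\<exists>p. \<forall>z. f z = poly p z)"

definition singular_values :: "(complex \<Rightarrow> complex) \<Rightarrow> complex set" where
  "singular_values f =
     (LEAST S. closed S \<and> covering_space (UNIV - f -` S) f (UNIV - S))"

text \<open>
  \<open>covering_space\<close> includes surjectivity. This is harmless here: a covering in the sense
  that allows empty fibres has a locally empty or locally non-empty fibre, and a transcendental
  entire function omits at most one value. The lemmas below show that the smallest set exists
  for every continuous \<open>f\<close>, so that \<open>LEAST\<close> is well defined.
\<close>

lemma covering_space_Inter: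
  fixes f :: "complex \<Rightarrow> complex"
  assumes cont: "continuous_on UNIV f" and ne: "\<S> \<noteq> {}"
    and P: "\<And>S. S \<in> \<S> \<Longrightarrow> closed S \<and> covering_space (UNIV - f -` S) f (UNIV - S)"
  shows "closed (\<Inter>\<S>) \<and> covering_space (UNIV - f -` (\<Inter>\<S>)) f (UNIV - \<Inter>\<S>)"
proof
  show "closed (\<Inter>\<S>)" using P by blast
  show "covering_space (UNIV - f -` (\<Inter>\<S>)) f (UNIV - \<Inter>\<S>)"
  proof
    show "continuous_on (UNIV - f -` (\<Inter>\<S>)) f"
      using cont continuous_on_subset by blast
    show "f ` (UNIV - f -` (\<Inter>\<S>)) = UNIV - \<Inter>\<S>"
    proof (intro equalityI subsetI)
      fix y assume "y \<in> UNIV - \<Inter>\<S>"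
      then obtain S where S: "S \<in> \<S>" "y \<in> UNIV - S" by blast
      moreover have "f ` (UNIV - f -` S) = UNIV - S"
        using P[OF S(1)] covering_space_imp_surjective by blast
      ultimately show "y \<in> f ` (UNIV - f -` (\<Inter>\<S>))" by blast
    qed auto
    fix y assume "y \<in> UNIV - \<Inter>\<S>"
    then obtain S where S: "S \<in> \<S>" "y \<in> UNIV - S" by blast
    have cS: "closed S" and cov: "covering_space (UNIV - f -` S) f (UNIV - S)"
      using P[OF S(1)] by auto
    have opS: "open (UNIV - S)" using cS by (simp add: open_Diff)
    have op: "open (UNIV - f -` S)"
      using cS cont by (simp add: open_Diff closed_vimage)
    obtain T v where T: "y \<in> T" "openin (top_of_set (UNIV - S)) T"
      and v: "\<Union>v = (UNIV - f -` S) \<inter> f -` T"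
        "\<And>u. u \<in> v \<Longrightarrow> openin (top_of_set (UNIV - f -` S)) u"
        "pairwise disjnt v" "\<And>u. u \<in> v \<Longrightarrow> \<exists>q. homeomorphism u T f q"
      using cov S(2) unfolding covering_space_def by metis
    have oT: "open T" "T \<subseteq> UNIV - S" using T(2) opS by (auto simp: openin_open_eq)
    show "\<exists>T. y \<in> T \<and> openin (top_of_set (UNIV - \<Inter>\<S>)) T \<and>
        (\<exists>v. \<Union>v = (UNIV - f -` \<Inter>\<S>) \<inter> f -` T \<and>
          (\<forall>u\<in>v. openin (top_of_set (UNIV - f -` \<Inter>\<S>)) u) \<and>
          pairwise disjnt v \<and> (\<forall>u\<in>v. \<exists>q. homeomorphism u T f q))"
    proof (intro exI[of _ T] exI[of _ v] conjI ballI)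
      show "y \<in> T" by fact
      show "openin (top_of_set (UNIV - \<Inter>\<S>)) T"
        using oT S(1) by (intro open_subset) auto
      show "\<Union>v = (UNIV - f -` \<Inter>\<S>) \<inter> f -` T"
        using v(1) oT(2) S(1) by auto
      show "pairwise disjnt v" by fact
      show "openin (top_of_set (UNIV - f -` \<Inter>\<S>)) u" if "u \<in> v" for u
      proof -
        have "open u \<and> u \<subseteq> UNIV - f -` S"
          using v(2)[OF that] op by (simp add: openin_open_eq)
        then show ?thesis using S(1) by (intro open_subset) auto
      qed
      show "\<exists>q. homeomorphism u T f q" if "u \<in> v" for u using v(4)[OF that] .
    qed
  qed
qed

lemma singular_values_eq_Inter:
  assumes "continuous_on UNIV f"
  shows "singular_values f =
    \<Inter>{S. closed S \<and> covering_space (UNIV - f -` S) f (UNIV - S)}"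
  unfolding singular_values_def
proof (rule Least_equality)
  let ?\<S> = "{S. closed S \<and> covering_space (UNIV - f -` S) f (UNIV - S)}"
  have "UNIV \<in> ?\<S>" by (simp add: covering_space_def)
  then show "closed (\<Inter>?\<S>) \<and> covering_space (UNIV - f -` (\<Inter>?\<S>)) f (UNIV - \<Inter>?\<S>)"
    by (intro covering_space_Inter[OF assms]) blast+
qed auto

lemma singular_values_least:
  assumes "continuous_on UNIV f"
  shows "closed (singular_values f)"
    and "covering_space (UNIV - f -` singular_values f) f (UNIV - singular_values f)"
    and "\<And>S. closed S \<Longrightarrow> covering_space (UNIV - f -` S) f (UNIV - S) \<Longrightarrow>
           singular_values f \<subseteq> S"
proof -
  let ?\<S> = "{S. closed S \<and> covering_space (UNIV - f -` S) f (UNIV - S)}"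
  have "UNIV \<in> ?\<S>" by (simp add: covering_space_def)
  then have "closed (\<Inter>?\<S>) \<and> covering_space (UNIV - f -` (\<Inter>?\<S>)) f (UNIV - \<Inter>?\<S>)"
    by (intro covering_space_Inter[OF assms]) blast+
  then show "closed (singular_values f)"
    and "covering_space (UNIV - f -` singular_values f) f (UNIV - singular_values f)"
    by (simp_all add: singular_values_eq_Inter[OF assms])
  show "\<And>S. closed S \<Longrightarrow> covering_space (UNIV - f -` S) f (UNIV - S) \<Longrightarrow>
           singular_values f \<subseteq> S"
    by (auto simp: singular_values_eq_Inter[OF assms])
qed

definition class_B :: "(complex \<Rightarrow> complex) set" where
  "class_B = {f. transcendental_entire f \<and> bounded (singular_values f)}"

text \<open>
  Great-circle distance on the unit sphere between the stereographic images of two points: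
  their chordal distance is \<open>2 * norm (z - w) / sqrt ((1 + (norm z)\<^sup>2) * (1 + (norm w)\<^sup>2))\<close>,
  and a chord of length \<open>l\<close> subtends the angle \<open>2 * arcsin (l / 2)\<close>.
\<close>

definition spherical_dist :: "complex \<Rightarrow> complex \<Rightarrow> real" where
  "spherical_dist z w =
     2 * arcsin (norm (z - w) / sqrt ((1 + (norm z)\<^sup>2) * (1 + (norm w)\<^sup>2)))"

definition spherically_equicontinuous_on ::
    "complex set \<Rightarrow> (nat \<Rightarrow> complex \<Rightarrow> complex) \<Rightarrow> bool" where
  "spherically_equicontinuous_on U F \<longleftrightarrow>
     (\<forall>z\<in>U. \<forall>e>0. \<exists>d>0. \<forall>w\<in>U. spherical_dist z w < d \<longrightarrow>
        (\<forall>n. spherical_dist (F n z) (F n w) < e))"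

definition fatou_set :: "(complex \<Rightarrow> complex) \<Rightarrow> complex set" where
  "fatou_set f =
     {z. \<exists>U. open U \<and> z \<in> U \<and> spherically_equicontinuous_on U (\<lambda>n. f ^^ n)}"

definition wandering_domain :: "(complex \<Rightarrow> complex) \<Rightarrow> complex set \<Rightarrow> bool" where
  "wandering_domain f W \<longleftrightarrow> W \<in> components (fatou_set f) \<and>
     (\<forall>n m. n \<noteq> m \<longrightarrow> (f ^^ n) ` W \<inter> (f ^^ m) ` W = {})"

end

theory Submission
  imports Defs "HOL-Complex_Analysis.Great_Picard" "HOL-Complex_Analysis.Riemann_Mapping"
begin

text \<open>
  Let \<open>z\<close> lie in a wandering domain \<open>W\<close>, and write \<open>z_n\<close> for its orbit. The logarithmic expansion
  of maps with bounded singular set shows that \<open>z_n\<close> cannot tend to infinity. Since the images of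
  \<open>W\<close> are disjoint, the derivative of \<open>f ^^ n\<close> tends to 0 along bounded times, so inverse branches
  along the orbit cannot exist on discs of definite size. As \<open>S(f)\<close> escapes uniformly, the only way
  to obstruct them is that for infinitely many \<open>n\<close> the point \<open>z_n\<close> is arbitrarily large while
  \<open>f z_n\<close> is arbitrarily close to \<open>S(f)\<close>. By the hypothesis on \<open>A\<close> such \<open>z_n\<close> lie far from \<open>A\<close>; in
  particular the orbit never meets \<open>A\<close>.

  All components of the complement of \<open>A\<close> are simply connected, and \<open>f\<close> expands their hyperbolic
  metric along the orbit, but by the Schwarz lemma the total expansion is bounded. Hence the
  expansion at \<open>z_n\<close> tends to 1, so \<open>f\<close> maps ever larger hyperbolic discs about \<open>z_n\<close> into the
  complement of \<open>A\<close>. At the times above, a Schottky estimate applied along a chain of discs then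
  shows that \<open>f\<close> stays close to \<open>S(f)\<close> on the whole circle of radius \<open>norm z_n\<close>. So \<open>f\<close> is
  bounded on arbitrarily large circles, hence constant.
\<close>

subsection \<open>Distortion and Schwarz-Pick estimates\<close>

text \<open>Schottky's bound \<open>exp (pi * exp (pi * (2 + 2 * r + 12 * t / (1 - t))))\<close> at
  \<open>r = 1\<close>, \<open>t = 2/3\<close>.\<close>

definition distortion_const :: real where
  "distortion_const = exp (pi * exp (pi * 28))"

lemma distortion_const_gt_1: "distortion_const > 1"
  unfolding distortion_const_def by simp

text \<open>The lower bound is the upper bound for the reciprocal of \<open>g\<close>, which also
  omits 0 and 1 and has modulus 1 at the centre.\<close>

lemma Schottky_distortion:
  assumes "g holomorphic_on cball 0 1" "norm (g 0) = 1"
    and "\<And>z. z \<in> cball 0 1 \<Longrightarrow> \<not>(g z = 0 \<or> g z = 1)" "norm z \<le> 2/3"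
  shows "norm (g z) \<le> distortion_const" "1 \<le> distortion_const * norm (g z)"
proof -
  have *: "norm (k z) \<le> distortion_const"
    if "k holomorphic_on cball 0 1" "norm (k 0) = 1"
       "\<And>z. z \<in> cball 0 1 \<Longrightarrow> \<not>(k z = 0 \<or> k z = 1)" for k :: "complex \<Rightarrow> complex"
    using Schottky[OF that(1) _ that(3), of 1 "2/3" z] that(2) assms(4)
    by (simp add: distortion_const_def)
  show "norm (g z) \<le> distortion_const" using *[OF assms(1-3)] .
  have "norm (inverse (g z)) \<le> distortion_const"
  proof (rule *[of "\<lambda>z. inverse (g z)"])
    show "(\<lambda>z. inverse (g z)) holomorphic_on cball 0 1"
      using assms by (intro holomorphic_intros) auto
  qed (use assms in \<open>auto simp: norm_inverse\<close>)
  moreover have "g z \<noteq> 0" using assms(3)[of z] assms(4) by simp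
  ultimately show "1 \<le> distortion_const * norm (g z)"
    by (simp add: norm_divide divide_simps split: if_splits)
qed

lemma connected_unbounded_meets_sphere:
  fixes K :: "complex set"
  assumes "connected K" "\<not> bounded K" "p \<in> K" "r \<ge> 0"
  obtains q where "q \<in> K" "norm (q - p) = r"
proof -
  have "connected ((\<lambda>q. norm (q - p)) ` K)"
    by (intro connected_continuous_image continuous_intros assms)
  moreover have "0 \<in> (\<lambda>q. norm (q - p)) ` K" using assms(3) by force
  moreover obtain q where "q \<in> K" "norm (q - p) > r"
  proof (rule ccontr)
    assume "\<not> thesis"
    then have "\<And>q. q \<in> K \<Longrightarrow> norm (q - p) \<le> r" using that not_le by blast
    then have "K \<subseteq> cball p r" by (auto simp: dist_norm norm_minus_commute)
    then show False using assms(2) bounded_subset bounded_cball by blast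
  qed
  ultimately have "r \<in> (\<lambda>q. norm (q - p)) ` K"
    using connectedD_interval[of "(\<lambda>q. norm (q - p)) ` K" 0 "norm (q - p)" r] assms(4) by auto
  then show ?thesis using that by auto
qed

text \<open>
  The second omitted value is chosen in \<open>K\<close> at distance \<open>norm (h x - p)\<close> from \<open>p\<close>, so that
  Schottky's theorem applies to a map normalized to have modulus 1 at the centre.
\<close>

lemma omitted_continuum_distortion:
  assumes h: "h holomorphic_on ball x r" and r: "r > 0"
    and K: "connected K" "\<not> bounded K" "p \<in> K" and omit: "h ` ball x r \<inter> K = {}"
    and y: "y \<in> cball x (r/2)"
  shows "norm (h y - p) \<le> distortion_const * norm (h x - p)"
    and "norm (h x - p) \<le> distortion_const * norm (h y - p)"
proof -
  have x: "x \<in> ball x r" using r by simp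
  have hx: "h x \<noteq> p" using omit K(3) x by blast
  obtain q where q: "q \<in> K" "norm (q - p) = norm (h x - p)"
    using connected_unbounded_meets_sphere[OF K] norm_ge_zero by blast
  then have qp: "q \<noteq> p" using hx by auto
  \<comment> \<open>The factor 3/4 keeps the closed unit disc inside \<open>ball x r\<close>, and
    3/4 times Schottky's radius 2/3 is the required 1/2.\<close>
  define g where "g \<zeta> = (h (x + of_real (3/4*r) * \<zeta>) - p) / (q - p)" for \<zeta>
  have in_ball: "x + of_real (3/4*r) * \<zeta> \<in> ball x r" if "\<zeta> \<in> cball 0 1" for \<zeta>
  proof -
    have "3/4*r * norm \<zeta> \<le> 3/4*r*1" using that r by (intro mult_left_mono) auto
    then show ?thesis using r by (simp add: dist_norm norm_mult)
  qed
  have g: "g holomorphic_on cball 0 1"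
    unfolding g_def
    by (intro holomorphic_intros holomorphic_on_compose_gen[OF _ h, unfolded o_def]) (use qp in_ball in auto)
  have g0: "norm (g 0) = 1" using q hx by (simp add: g_def norm_divide)
  have g01: "\<not>(g \<zeta> = 0 \<or> g \<zeta> = 1)" if "\<zeta> \<in> cball 0 1" for \<zeta>
  proof -
    have "h (x + of_real (3/4*r) * \<zeta>) \<notin> K" using in_ball[OF that] omit by blast
    then show ?thesis using K(3) q(1) qp unfolding g_def by auto
  qed
  define \<zeta> where "\<zeta> = (y - x) / of_real (3/4*r)"
  have "norm (y - x) \<le> r/2" using y by (simp add: dist_norm norm_minus_commute)
  then have n: "norm \<zeta> \<le> 2/3"
    unfolding \<zeta>_def norm_divide norm_of_real using r by (simp add: field_simps)
  have "x + of_real (3/4*r) * \<zeta> = y" using r by (simp add: \<zeta>_def field_simps)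
  then have gy: "norm (g \<zeta>) = norm (h y - p) / norm (h x - p)"
    using q by (simp add: g_def norm_divide)
  show "norm (h y - p) \<le> distortion_const * norm (h x - p)"
    and "norm (h x - p) \<le> distortion_const * norm (h y - p)"
    using Schottky_distortion[OF g g0 g01 n] hx unfolding gy by (simp_all add: field_simps)
qed

text \<open>Cauchy's estimate for \<open>h - p\<close> on the circle of radius \<open>r/2\<close>,
  where the distortion bound controls it.\<close>

lemma omitted_continuum_deriv_bound:
  assumes h: "h holomorphic_on ball x r" and r: "r > 0"
    and K: "connected K" "\<not> bounded K" "p \<in> K" and omit: "h ` ball x r \<inter> K = {}"
  shows "norm (deriv h x) \<le> 2 * distortion_const * norm (h x - p) / r"
proof -
  have "norm ((deriv ^^ 1) (\<lambda>z. h z - p) x) \<le> fact 1 * (distortion_const * norm (h x - p)) / (r/2)^1"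
  proof (rule Cauchy_inequality)
    have hol: "(\<lambda>z. h z - p) holomorphic_on ball x r" by (intro holomorphic_intros h)
    show "(\<lambda>z. h z - p) holomorphic_on ball x (r/2)"
      using r by (intro holomorphic_on_subset[OF hol]) auto
    show "continuous_on (cball x (r/2)) (\<lambda>z. h z - p)"
      using r by (intro holomorphic_on_imp_continuous_on holomorphic_on_subset[OF hol]) auto
    show "norm (h z - p) \<le> distortion_const * norm (h x - p)" if "norm (x - z) = r/2" for z
      using omitted_continuum_distortion(1)[OF assms, of z] that by (simp add: dist_norm)
  qed (use r in auto)
  moreover have "deriv (\<lambda>z. h z - p) x = deriv h x"
    using holomorphic_on_imp_differentiable_at[OF h, of x] r by (subst deriv_diff) auto
  ultimately show ?thesis by (simp add: ac_simps)
qed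

text \<open>The image is homeomorphic to a convex set, hence simply connected, so all components of
  its complement are unbounded; \<open>K\<close> is the one containing \<open>p\<close>.\<close>

lemma injective_image_omitted_continuum:
  assumes "open X" "convex X" "X \<noteq> {}" "h holomorphic_on X" "inj_on h X" "p \<notin> h ` X"
  obtains K where "connected K" "\<not> bounded K" "p \<in> K" "h ` X \<inter> K = {}"
proof -
  have op: "open (h ` X)" using open_mapping_thm3 assms by blast
  have "\<exists>g. homeomorphism X (h ` X) h g"
    by (rule invariance_of_domain_homeomorphism[of X h])
      (use assms in \<open>auto intro: holomorphic_on_imp_continuous_on\<close>)
  then have "X homeomorphic (h ` X)" by (auto simp: homeomorphic_def)
  then have "simply_connected (h ` X)"
    using convex_imp_simply_connected assms(2) homeomorphic_simply_connected_eq by blast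
  then have "\<forall>C\<in>components (- (h ` X)). \<not> bounded C"
    using simply_connected_eq_unbounded_complement_components[OF op] by blast
  moreover have "connected_component_set (- (h ` X)) p \<in> components (- (h ` X))"
    using assms(6) by (auto simp: components_def)
  ultimately show ?thesis
    using assms(6) connected_component_subset[of "- (h ` X)" p]
    by (intro that[of "connected_component_set (- (h ` X)) p"]) (auto simp: connected_component_refl)
qed

section \<open>Holomorphic self-maps of the unit disc\<close>

lemma Moebius_normalization:
  assumes h: "h holomorphic_on ball 0 1" and "\<And>z. norm z < 1 \<Longrightarrow> norm (h z) < 1"
  defines "g \<equiv> \<lambda>z. Moebius_function 0 (h 0) (h z)"
  shows "g holomorphic_on ball 0 1" "g 0 = 0" "\<And>z. norm z < 1 \<Longrightarrow> norm (g z) < 1"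
    "deriv g 0 = deriv h 0 / of_real (1 - (norm (h 0))\<^sup>2)"
proof -
  have h0: "norm (h 0) < 1" using assms(2)[of 0] by simp
  show "g holomorphic_on ball 0 1"
    unfolding g_def
    by (rule holomorphic_on_compose_gen[OF h Moebius_function_holomorphic[OF h0], unfolded o_def])
      (use assms(2) in auto)
  show "g 0 = 0" by (simp add: g_def Moebius_function_eq_zero)
  show "\<And>z. norm z < 1 \<Longrightarrow> norm (g z) < 1"
    unfolding g_def by (intro Moebius_function_norm_lt_1 h0 assms(2))
  have "cnj (h 0) * h 0 = of_real ((norm (h 0))\<^sup>2)"
    by (metis complex_norm_square mult.commute)
  moreover have "(norm (h 0))\<^sup>2 < 1" using h0 by (simp add: power_less_one_iff abs_square_less_1)
  moreover have "(h has_field_derivative deriv h 0) (at 0)"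
    using h by (simp add: holomorphic_derivI)
  ultimately have "(g has_field_derivative deriv h 0 / of_real (1 - (norm (h 0))\<^sup>2)) (at 0)"
    unfolding g_def Moebius_function_simple
    by (auto intro!: derivative_eq_intros simp: divide_simps simp flip: of_real_power)
  then show "deriv g 0 = deriv h 0 / of_real (1 - (norm (h 0))\<^sup>2)" by (rule DERIV_imp_deriv)
qed

lemma Schwarz_Pick_deriv_0:
  assumes h: "h holomorphic_on ball 0 1" and "\<And>z. norm z < 1 \<Longrightarrow> norm (h z) < 1"
  shows "norm (deriv h 0) \<le> 1 - (norm (h 0))\<^sup>2"
proof -
  have "(norm (h 0))\<^sup>2 < 1" using assms(2)[of 0] by (simp add: abs_square_less_1)
  moreover have "norm (deriv h 0 / of_real (1 - (norm (h 0))\<^sup>2)) \<le> 1"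
    using Schwarz_Lemma(2)[OF Moebius_normalization(1-3)[OF assms], of 0]
      Moebius_normalization(4)[OF assms] by simp
  ultimately show ?thesis
    by (simp add: norm_divide divide_le_eq del: of_real_diff)
qed

text \<open>A disc automorphism sending \<open>h c\<close> to 0 takes \<open>h y\<close> to some
  \<open>u\<close> of modulus at most 1/2, by the Schwarz lemma. In 3/16, the 3/4 comes from one
  minus the square of \<open>norm u\<close>, the 1/4 from the squared denominator
  \<open>D\<close>.\<close>

lemma Schwarz_Pick_half:
  assumes h: "h holomorphic_on ball c r" and r: "r > 0"
    and lt: "\<And>z. z \<in> ball c r \<Longrightarrow> norm (h z) < 1" and y: "norm (y - c) \<le> r / 2"
  shows "3/16 * (1 - (norm (h c))\<^sup>2) \<le> 1 - (norm (h y))\<^sup>2"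
proof -
  define k where "k \<zeta> = h (c + of_real r * \<zeta>)" for \<zeta>
  have in_ball: "c + of_real r * \<zeta> \<in> ball c r" if "norm \<zeta> < 1" for \<zeta>
    using that r by (simp add: dist_norm norm_mult)
  have k: "k holomorphic_on ball 0 1" "\<And>\<zeta>. norm \<zeta> < 1 \<Longrightarrow> norm (k \<zeta>) < 1"
    unfolding k_def
    by (intro holomorphic_intros holomorphic_on_compose_gen[OF _ h, unfolded o_def])
      (use in_ball lt in auto)
  define \<zeta> where "\<zeta> = (y - c) / of_real r"
  have \<zeta>: "norm \<zeta> \<le> 1/2" using y r by (simp add: \<zeta>_def norm_divide field_simps)
  have k0: "k 0 = h c" and ky: "k \<zeta> = h y" using r by (simp_all add: k_def \<zeta>_def)
  have hc: "norm (h c) < 1" and hy: "norm (h y) < 1"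
    using k(2)[of 0] k(2)[of \<zeta>] \<zeta> k0 ky by simp_all
  define u where "u = Moebius_function 0 (h c) (h y)"
  have "norm u \<le> norm \<zeta>"
    using Schwarz_Lemma(1)[OF Moebius_normalization(1-3)[OF k], of \<zeta>] \<zeta> k0 ky unfolding u_def by simp
  then have u: "norm u \<le> 1/2" using \<zeta> by simp
  have "h y = Moebius_function 0 (- h c) u"
    unfolding u_def using Moebius_function_compose[of "- h c" "h c" "h y"] hc hy by simp
  then have hyu: "h y = (u + h c) / (1 + cnj (h c) * u)"
    by (simp add: Moebius_function_simple)
  define D where "D = 1 + cnj (h c) * u"
  have small: "norm (cnj (h c) * u) \<le> 1/2"
    using mult_mono[of "norm (h c)" 1 "norm u" "1/2"] hc u by (simp add: norm_mult)
  have D1: "norm D \<le> 2" unfolding D_def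
    using norm_triangle_ineq[of 1 "cnj (h c) * u"] small by simp
  have D0: "D \<noteq> 0"
  proof
    assume "D = 0"
    then have "cnj (h c) * u = -1" unfolding D_def by (simp add: eq_neg_iff_add_eq_0 add.commute)
    then show False using small by simp
  qed
  have id: "(norm D)\<^sup>2 - (norm (u + h c))\<^sup>2 = (1 - (norm u)\<^sup>2) * (1 - (norm (h c))\<^sup>2)"
    unfolding D_def by (simp only: cmod_power2) (simp add: power2_eq_square algebra_simps)
  have "1 - (norm (h y))\<^sup>2 = ((norm D)\<^sup>2 - (norm (u + h c))\<^sup>2) / (norm D)\<^sup>2"
    using D0 unfolding hyu D_def[symmetric] by (simp add: norm_divide power_divide diff_divide_distrib)
  also have "\<dots> = (1 - (norm u)\<^sup>2) * (1 - (norm (h c))\<^sup>2) / (norm D)\<^sup>2" by (simp add: id)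
  also have "\<dots> \<ge> (3/4) * (1 - (norm (h c))\<^sup>2) / 4"
  proof (intro frac_le mult_mono)
    have "(norm u)\<^sup>2 \<le> (1/2)\<^sup>2" using u by (intro power_mono) auto
    then show "3/4 \<le> 1 - (norm u)\<^sup>2" by (simp add: power2_eq_square)
    have "(norm D)\<^sup>2 \<le> 2\<^sup>2" using D1 by (intro power_mono) auto
    then show "(norm D)\<^sup>2 \<le> 4" by simp
    show "0 \<le> 1 - (norm (h c))\<^sup>2" using hc by (simp add: abs_square_le_1)
    then show "0 \<le> (1 - (norm u)\<^sup>2) * (1 - (norm (h c))\<^sup>2)"
      using \<open>3/4 \<le> 1 - (norm u)\<^sup>2\<close> by simp
    show "0 \<le> 1 - (norm u)\<^sup>2" using \<open>3/4 \<le> 1 - (norm u)\<^sup>2\<close> by simp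
  qed (use D0 in auto)
  finally show ?thesis by simp
qed

text \<open>Moving \<open>w\<close> to 0 by a disc automorphism yields a zero-free map with a
  holomorphic square root \<open>q\<close>, to which Schwarz-Pick applies. In effect, a derivative
  of modulus near 1 forces \<open>b\<close> to cover a large disc.\<close>

lemma disc_map_omitting_value_deriv_bound:
  assumes b: "b holomorphic_on ball 0 1" "b 0 = 0" "\<And>z. norm z < 1 \<Longrightarrow> norm (b z) < 1"
    and w: "norm w < 1" "w \<notin> b ` ball 0 1"
  shows "norm (deriv b 0) * (1 + norm w) \<le> 2 * sqrt (norm w)"
proof -
  define g where "g z = Moebius_function 0 w (b z)" for z
  have g: "g holomorphic_on ball 0 1"
    unfolding g_def
    by (rule holomorphic_on_compose_gen[OF b(1) Moebius_function_holomorphic[OF w(1)], unfolded o_def])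
      (use b(3) in auto)
  have lt: "norm (g z) < 1" if "norm z < 1" for z
    unfolding g_def by (intro Moebius_function_norm_lt_1 w b(3) that)
  have nz: "g z \<noteq> 0" if z: "z \<in> ball 0 1" for z
  proof
    assume "g z = 0"
    then have "b z = w \<or> 1 - cnj w * b z = 0"
      unfolding g_def Moebius_function_simple by auto
    moreover have "norm (cnj w * b z) < 1"
      using norm_mult_less[of "cnj w" 1 "b z" 1] w b(3)[of z] z by auto
    ultimately show False using w(2) z by force
  qed
  obtain q where q: "q holomorphic_on ball 0 1" "\<And>z. z \<in> ball 0 1 \<Longrightarrow> g z = (q z)\<^sup>2"
    using contractible_imp_holomorphic_sqrt[OF g _ nz] convex_imp_contractible[OF convex_ball]
    by blast
  have qlt: "norm (q z) < 1" if "norm z < 1" for z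
    using lt[OF that] q(2)[of z] that by (simp add: norm_power abs_square_less_1)
  have sp: "norm (deriv q 0) \<le> 1 - (norm (q 0))\<^sup>2" by (rule Schwarz_Pick_deriv_0[OF q(1) qlt])
  have q0: "(norm (q 0))\<^sup>2 = norm w"
    using arg_cong[OF q(2)[of 0], of norm] b(2) by (simp add: g_def Moebius_function_of_zero norm_power)
  have "(g has_field_derivative 2 * q 0 * deriv q 0) (at 0)"
  proof (rule has_field_derivative_transform_within[where S = UNIV and d = 1])
    show "((\<lambda>z. (q z)\<^sup>2) has_field_derivative 2 * q 0 * deriv q 0) (at 0)"
      using holomorphic_derivI[OF q(1), of 0] by (auto intro!: derivative_eq_intros)
    show "\<And>z. z \<in> UNIV \<Longrightarrow> dist z 0 < 1 \<Longrightarrow> (q z)\<^sup>2 = g z" using q(2) by simp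
  qed auto
  moreover have "(g has_field_derivative deriv b 0 * of_real (1 - (norm w)\<^sup>2)) (at 0)"
  proof -
    have "cnj w * w = of_real ((norm w)\<^sup>2)" by (metis complex_norm_square mult.commute)
    then show ?thesis
      unfolding g_def Moebius_function_simple
      using holomorphic_derivI[OF b(1), of 0] b(2)
      by (auto intro!: derivative_eq_intros simp: algebra_simps simp flip: of_real_power)
  qed
  ultimately have "2 * q 0 * deriv q 0 = deriv b 0 * of_real (1 - (norm w)\<^sup>2)"
    by (rule DERIV_unique)
  then have "norm (2 * q 0 * deriv q 0) = norm (deriv b 0 * of_real (1 - (norm w)\<^sup>2))" by simp
  moreover have w2: "(norm w)\<^sup>2 < 1" using w by (simp add: abs_square_less_1)
  ultimately have eq: "norm (deriv b 0) * (1 - (norm w)\<^sup>2) = 2 * norm (q 0) * norm (deriv q 0)"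
    by (simp add: norm_mult del: of_real_diff)
  have "norm (q 0) = sqrt (norm w)" using q0 by (metis norm_ge_zero real_sqrt_unique)
  then have "norm (deriv b 0) * (1 - (norm w)\<^sup>2) \<le> 2 * sqrt (norm w) * (1 - norm w)"
    unfolding eq using sp q0 by (intro mult_mono) auto
  then have "(norm (deriv b 0) * (1 + norm w)) * (1 - norm w) \<le> 2 * sqrt (norm w) * (1 - norm w)"
    by (simp add: power2_eq_square algebra_simps)
  then show ?thesis using w by simp
qed

subsection \<open>Riemann maps and entire functions\<close>

text \<open>A component \<open>C\<close> of the complement of the set meets \<open>A\<close>:
  otherwise \<open>C\<close> would contain the closure of another component of \<open>- A\<close>,
  whose frontier lies in \<open>A\<close>. So \<open>C\<close> contains an unbounded component of
  \<open>A\<close>.\<close>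

lemma simply_connected_component_of_Compl:
  fixes A :: "complex set"
  assumes "closed A" and A: "\<forall>C\<in>components A. \<not> bounded C" and x: "x \<notin> A"
  shows "open (connected_component_set (- A) x)" "simply_connected (connected_component_set (- A) x)"
proof -
  let ?U = "connected_component_set (- A) x"
  show op: "open ?U" using assms(1) by (intro open_connected_component) (simp add: open_Compl)
  have meets: "C \<inter> A \<noteq> {}" if C: "C \<in> components (- ?U)" for C
  proof
    assume CA: "C \<inter> A = {}"
    obtain y where y: "y \<in> C" using C in_components_nonempty by blast
    have cC: "closed C" using C op closed_components[of "- ?U"] by (simp add: closed_Compl)
    let ?V = "connected_component_set (- A) y"
    have yA: "y \<in> - A" using CA y by blast
    then have yV: "y \<in> ?V" by (simp add: connected_component_refl)
    have disj: "?V \<inter> ?U = {}"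
    proof (rule ccontr)
      assume "?V \<inter> ?U \<noteq> {}"
      then obtain v where "connected_component (- A) y v" "connected_component (- A) x v" by blast
      then have "connected_component (- A) x y"
        using connected_component_sym connected_component_trans by blast
      then show False using in_components_subset[OF C] y by blast
    qed
    then have "?V \<subseteq> C"
      using y yV by (intro components_maximal[OF C]) auto
    then have Vsub: "closure ?V \<subseteq> C" using cC closure_minimal by blast
    have opV: "open ?V" using assms(1) by (intro open_connected_component) (simp add: open_Compl)
    have "x \<in> ?U" using x by (simp add: connected_component_refl)
    then have "?V \<noteq> UNIV" using disj by blast
    moreover have "?V \<noteq> {}" using yV by blast
    ultimately have "frontier ?V \<noteq> {}" by (metis frontier_eq_empty)
    then obtain u where u: "u \<in> frontier ?V" by blast
    then have "u \<in> closure ?V" "u \<notin> ?V" using opV by (auto simp: frontier_def interior_open)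
    have "u \<notin> - A"
    proof
      assume "u \<in> - A"
      have "connected (insert u ?V)"
        using \<open>u \<in> closure ?V\<close> closure_subset[of ?V]
        by (intro connected_intermediate_closure[OF connected_connected_component[of "- A" y]]) blast+
      then have "insert u ?V \<subseteq> ?V"
        using \<open>u \<in> - A\<close> yV connected_component_subset[of "- A" y]
        by (intro connected_component_maximal) blast+
      then show False using \<open>u \<notin> ?V\<close> by blast
    qed
    then show False using CA Vsub \<open>u \<in> closure ?V\<close> by blast
  qed
  have "\<not> bounded C" if C: "C \<in> components (- ?U)" for C
  proof -
    obtain a where a: "a \<in> C" "a \<in> A" using meets[OF C] by blast
    let ?K = "connected_component_set A a"
    have "?K \<in> components A" using a by (auto simp: components_def)
    then have "\<not> bounded ?K" using A by blast
    moreover have "a \<in> ?K" using a by (simp add: connected_component_refl)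
    then have "?K \<subseteq> C"
      using a connected_component_subset[of A a] connected_component_subset[of "- A" x]
      by (intro components_maximal[OF C]) blast+
    ultimately show ?thesis using bounded_subset by blast
  qed
  then show "simply_connected ?U"
    using simply_connected_eq_unbounded_complement_components[OF op] by simp
qed

text \<open>A Riemann map followed by a disc automorphism moving the image of \<open>x\<close> to 0;
  the component is proper because \<open>A\<close> is nonempty.\<close>

lemma Riemann_map_component_of_Compl:
  fixes A :: "complex set"
  assumes "closed A" "\<forall>C\<in>components A. \<not> bounded C" "x \<notin> A" "A \<noteq> {}"
  obtains \<psi> \<phi> where "\<psi> holomorphic_on ball 0 1" "\<psi> ` ball 0 1 \<subseteq> connected_component_set (- A) x"
    "\<psi> 0 = x" "\<phi> x = 0" "\<phi> holomorphic_on connected_component_set (- A) x"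
    "\<phi> ` connected_component_set (- A) x \<subseteq> ball 0 1"
    "\<And>\<zeta>. \<zeta> \<in> ball 0 1 \<Longrightarrow> \<phi> (\<psi> \<zeta>) = \<zeta>"
    "\<And>y. y \<in> connected_component_set (- A) x \<Longrightarrow> \<psi> (\<phi> y) = y"
proof -
  let ?U = "connected_component_set (- A) x"
  note sc = simply_connected_component_of_Compl[OF assms(1-3)]
  have xU: "x \<in> ?U" using assms(3) connected_component_refl[of x "- A"] by auto
  have "?U \<noteq> {}" using xU by blast
  have "?U \<noteq> UNIV" using assms(4) connected_component_subset[of "- A" x] by auto
  have "?U = {} \<or> ?U = UNIV \<or> (\<exists>f g. f holomorphic_on ?U \<and> g holomorphic_on ball 0 1 \<and>
      (\<forall>z\<in>?U. f z \<in> ball 0 1 \<and> g (f z) = z) \<and> (\<forall>z\<in>ball 0 1. g z \<in> ?U \<and> f (g z) = z))"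
    by (rule iffD1[OF Riemann_mapping_theorem]) (intro conjI sc)
  then obtain f g where f: "f holomorphic_on ?U" and g: "g holomorphic_on ball 0 1"
    and fU: "\<forall>z\<in>?U. f z \<in> ball 0 1 \<and> g (f z) = z"
    and gD: "\<forall>z\<in>ball 0 1. g z \<in> ?U \<and> f (g z) = z"
    using \<open>?U \<noteq> {}\<close> \<open>?U \<noteq> UNIV\<close> by (elim disjE exE conjE) simp_all
  obtain F G where F: "F (f x) = 0" "F holomorphic_on ball 0 1" "F ` ball 0 1 \<subseteq> ball 0 1"
    and G: "G holomorphic_on ball 0 1" "G ` ball 0 1 \<subseteq> ball 0 1"
    and FG: "\<And>z. z \<in> ball 0 1 \<Longrightarrow> F (G z) = z" "\<And>z. z \<in> ball 0 1 \<Longrightarrow> G (F z) = z"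
    using ball_biholomorphism_exists[of "f x"] fU xU by blast
  show ?thesis
  proof (rule that[of "g \<circ> G" "F \<circ> f"])
    show "g \<circ> G holomorphic_on ball 0 1" by (rule holomorphic_on_compose_gen[OF G(1) g G(2)])
    show "F \<circ> f holomorphic_on ?U" using fU by (intro holomorphic_on_compose_gen[OF f F(2)]) auto
    show "(g \<circ> G) ` ball 0 1 \<subseteq> ?U" using G(2) gD by force
    show "(F \<circ> f) ` ?U \<subseteq> ball 0 1" using F(3) fU by force
    show "(g \<circ> G) 0 = x" using F(1) FG(2)[of "f x"] fU xU by simp
    show "(F \<circ> f) x = 0" using F(1) by simp
    show "(F \<circ> f) ((g \<circ> G) \<zeta>) = \<zeta>" if "\<zeta> \<in> ball 0 1" for \<zeta>
      using FG(1)[OF that] G(2) gD that by force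
    show "(g \<circ> G) ((F \<circ> f) y) = y" if "y \<in> ?U" for y
      using FG(2)[of "f y"] fU that by auto
  qed
qed

section \<open>Polynomials and injectivity among entire functions\<close>

lemma entire_tendsto_infinity_imp_poly:
  fixes f :: "complex \<Rightarrow> complex"
  assumes "f holomorphic_on UNIV" and "\<And>B. \<exists>R. \<forall>z. norm z > R \<longrightarrow> norm (f z) > B"
  shows "\<exists>p. \<forall>z. f z = poly p z"
proof -
  have "filterlim f at_infinity at_infinity"
    unfolding filterlim_at_infinity[OF order_refl] eventually_at_infinity
  proof (intro allI impI)
    fix B :: real
    obtain R where "\<forall>z. norm z > R \<longrightarrow> norm (f z) > B" using assms(2) by blast
    then show "\<exists>b. \<forall>x. b \<le> norm x \<longrightarrow> B \<le> norm (f x)"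
      by (intro exI[of _ "R + 1"]) (auto intro: less_imp_le)
  qed
  then have "((inverse \<circ> f) \<longlongrightarrow> 0) at_infinity"
    unfolding o_def by (rule filterlim_compose[OF tendsto_inverse_0])
  then obtain a n where "\<And>z. f z = (\<Sum>i\<le>n. a i * z ^ i)"
    using pole_at_infinity[OF assms(1)] by blast
  then have "\<forall>z. f z = poly (\<Sum>i\<le>n. monom (a i) i) z"
    by (simp add: poly_sum poly_monom)
  then show ?thesis by blast
qed

text \<open>An injective \<open>f\<close> has simply connected range. If the range is proper, a
  Riemann map and Liouville's theorem give a contradiction; if it is the plane, \<open>f\<close>
  tends to infinity and is a polynomial. The pair later yields a value that inverse branches must
  omit.\<close>

lemma transcendental_not_injective:
  assumes "transcendental_entire f"
  obtains p q where "p \<noteq> q" "f p = f q"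
proof (cases "inj f")
  case True
  have f: "f holomorphic_on UNIV" using assms by (simp add: transcendental_entire_def)
  have op: "open (range f)" using open_mapping_thm3[OF f] True by simp
  obtain g where g: "g holomorphic_on range f" "\<And>z. g (f z) = z"
    by (rule holomorphic_has_inverse[OF f open_UNIV True]) (metis UNIV_I)
  have "\<exists>g. homeomorphism UNIV (range f) f g"
    by (rule invariance_of_domain_homeomorphism[of UNIV f])
      (use f True in \<open>auto intro: holomorphic_on_imp_continuous_on\<close>)
  then have "(UNIV :: complex set) homeomorphic range f" by (auto simp: homeomorphic_def)
  then have sc: "simply_connected (range f)"
    using convex_imp_simply_connected[OF convex_UNIV] homeomorphic_simply_connected_eq by blast
  have "range f = UNIV"
  proof (rule ccontr)
    assume "range f \<noteq> UNIV"
    moreover have "range f = {} \<or> range f = UNIV \<or> (\<exists>F G. F holomorphic_on range f \<and>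
        G holomorphic_on ball 0 1 \<and> (\<forall>z\<in>range f. F z \<in> ball 0 1 \<and> G (F z) = z) \<and>
        (\<forall>z\<in>ball 0 1. G z \<in> range f \<and> F (G z) = z))"
      by (rule iffD1[OF Riemann_mapping_theorem]) (intro conjI op sc)
    ultimately obtain F G where
      F: "F holomorphic_on range f" "\<forall>z\<in>range f. F z \<in> ball 0 1 \<and> G (F z) = z"
      by blast
    have "(F \<circ> f) holomorphic_on UNIV" by (rule holomorphic_on_compose_gen[OF f F(1)]) auto
    moreover have "bounded (range (F \<circ> f))"
      using F(2) by (intro bounded_subset[OF bounded_ball[of 0 1]]) auto
    ultimately have "(F \<circ> f) constant_on UNIV" by (rule Liouville_theorem)
    then have "F (f 0) = F (f 1)" by (auto simp: constant_on_def)
    then have "G (F (f 0)) = G (F (f 1))" by simp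
    then have "f 0 = f 1" using F(2) by simp
    then show False using True by (simp add: inj_eq)
  qed
  have "\<exists>R. \<forall>z. norm z > R \<longrightarrow> norm (f z) > B" for B
  proof -
    have "continuous_on (cball 0 B) g"
      using g(1) \<open>range f = UNIV\<close>
      by (intro holomorphic_on_imp_continuous_on) (auto intro: holomorphic_on_subset)
    then have "bounded (g ` cball 0 B)"
      by (intro compact_imp_bounded compact_continuous_image) auto
    then obtain R where R: "\<forall>w\<in>cball 0 B. norm (g w) \<le> R" by (auto simp: bounded_iff)
    have "norm (f z) > B" if "norm z > R" for z
      using R[rule_format, of "f z"] g(2)[of z] that by (cases "norm (f z) \<le> B") auto
    then show ?thesis by blast
  qed
  then show ?thesis
    using entire_tendsto_infinity_imp_poly[OF f] assms unfolding transcendental_entire_def by blast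
next
  case False
  then show ?thesis using that by (auto simp: inj_def)
qed

subsection \<open>The spherical metric and the Fatou set\<close>

text \<open>Half the chordal distance on the unit sphere, that is, the sine of half the spherical
  distance.\<close>

definition chordal_ratio :: "complex \<Rightarrow> complex \<Rightarrow> real" where
  "chordal_ratio z w = norm (z - w) / sqrt ((1 + (norm z)\<^sup>2) * (1 + (norm w)\<^sup>2))"

lemma spherical_dist_chordal: "spherical_dist z w = 2 * arcsin (chordal_ratio z w)"
  by (simp add: spherical_dist_def chordal_ratio_def)

lemma chordal_ratio_le_1: "chordal_ratio z w \<le> 1"
proof -
  have "(norm (z - w))\<^sup>2 \<le> (norm z + norm w)\<^sup>2"
    by (intro power_mono norm_triangle_ineq4) simp
  also have "\<dots> \<le> (1 + (norm z)\<^sup>2) * (1 + (norm w)\<^sup>2)"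
    using zero_le_power2[of "norm z * norm w - 1"] by (simp add: power2_eq_square algebra_simps)
  finally have "norm (z - w) \<le> sqrt ((1 + (norm z)\<^sup>2) * (1 + (norm w)\<^sup>2))"
    by (rule real_le_rsqrt)
  then show ?thesis unfolding chordal_ratio_def by (simp add: divide_le_eq_1 add_pos_nonneg)
qed

lemma chordal_ratio_nonneg: "0 \<le> chordal_ratio z w"
  by (simp add: chordal_ratio_def)

lemma chordal_ratio_less:
  assumes "spherical_dist z w < 2 * e"
  shows "chordal_ratio z w < e"
proof -
  let ?a = "arcsin (chordal_ratio z w)"
  have "0 \<le> ?a" using arcsin_le_mono[of 0 "chordal_ratio z w"] chordal_ratio_le_1 chordal_ratio_nonneg
    by (simp add: arcsin_nonneg)
  then have "sin ?a \<le> ?a" by (rule sin_x_le_x)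
  moreover have "sin ?a = chordal_ratio z w"
    using chordal_ratio_le_1[of z w] chordal_ratio_nonneg[of z w] by (intro sin_arcsin) auto
  ultimately show ?thesis using assms by (simp add: spherical_dist_chordal)
qed

lemma spherical_dist_commute: "spherical_dist z w = spherical_dist w z"
  by (simp add: spherical_dist_def norm_minus_commute mult.commute)

lemma spherical_dist_less_imp_close:
  assumes B: "B \<ge> 0" and e: "e > 0"
  obtains d where "d > 0" "\<And>x y. norm x \<le> B \<Longrightarrow> spherical_dist x y < d \<Longrightarrow> norm (x - y) < e"
proof -
  \<comment> \<open>The first bound makes the coefficient of \<open>norm (x - y)\<close> at most
    1/2, so that term can be absorbed; the second leaves \<open>e/2\<close>.\<close>
  define t where "t = min (1 / (2 * (1 + B))) (e / (2 * (1 + B)\<^sup>2))"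
  have t: "t > 0" "t * (1 + B) \<le> 1/2" "t * (1 + B)\<^sup>2 \<le> e/2"
    using B e unfolding t_def by (auto simp: min_def field_simps)
  show ?thesis
  proof (rule that[of "2 * t"])
    fix x y :: complex assume x: "norm x \<le> B" and sd: "spherical_dist x y < 2 * t"
    define S where "S = sqrt ((1 + (norm x)\<^sup>2) * (1 + (norm y)\<^sup>2))"
    have S0: "S > 0" unfolding S_def by (simp add: add_pos_nonneg)
    have "norm (x - y) < t * S"
      using chordal_ratio_less[OF sd] S0 unfolding chordal_ratio_def S_def[symmetric]
      by (simp add: field_simps)
    moreover have "S \<le> (1 + B) * (1 + B + norm (x - y))"
    proof -
      have *: "sqrt (1 + u\<^sup>2) \<le> 1 + u" if "u \<ge> 0" for u :: real
        using that by (intro real_le_lsqrt) (auto simp: power2_eq_square algebra_simps)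
      have "sqrt (1 + (norm x)\<^sup>2) \<le> 1 + B" using *[of "norm x"] x by simp
      moreover have "sqrt (1 + (norm y)\<^sup>2) \<le> 1 + B + norm (x - y)"
        using *[of "norm y"] x norm_triangle_ineq2[of y x] by (simp add: norm_minus_commute)
      ultimately show ?thesis
        unfolding S_def real_sqrt_mult using B by (intro mult_mono) auto
    qed
    then have "t * S \<le> t * ((1 + B) * (1 + B + norm (x - y)))"
      using t(1) by (intro mult_left_mono) auto
    also have "\<dots> = t * (1 + B)\<^sup>2 + (t * (1 + B)) * norm (x - y)"
      by (simp add: power2_eq_square algebra_simps)
    also have "\<dots> \<le> e/2 + 1/2 * norm (x - y)"
      using t by (intro add_mono mult_right_mono) auto
    finally show "norm (x - y) < e" using \<open>norm (x - y) < t * S\<close> by simp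
  qed (use t in auto)
qed

lemma spherical_dist_tendsto_0:
  assumes "d > 0"
  obtains r where "r > 0" "\<And>w. w \<in> ball z r \<Longrightarrow> spherical_dist z w < d"
proof -
  have "1 + (norm w)\<^sup>2 \<noteq> 0" for w :: complex
    using zero_le_power2[of "norm w"] by linarith
  then have "isCont (\<lambda>w. chordal_ratio z w) z"
    unfolding chordal_ratio_def by (intro continuous_intros) simp
  moreover have "isCont arcsin (chordal_ratio z z)"
    by (rule isCont_arcsin) (simp_all add: chordal_ratio_def)
  ultimately have "isCont (\<lambda>w. 2 * arcsin (chordal_ratio z w)) z"
    by (intro continuous_intros isCont_o2[of z "chordal_ratio z" arcsin])
  then have "isCont (spherical_dist z) z" by (simp add: spherical_dist_chordal[abs_def])
  then obtain r where "r > 0" "\<And>w. dist w z < r \<Longrightarrow> dist (spherical_dist z w) (spherical_dist z z) < d"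
    using assms unfolding continuous_at_eps_delta by blast
  moreover have "spherical_dist z z = 0" by (simp add: spherical_dist_def)
  ultimately show ?thesis
    by (intro that[of r]) (auto simp: dist_commute dist_real_def abs_less_iff)
qed

lemma open_fatou_set: "open (fatou_set f)"
  unfolding fatou_set_def by (subst open_subopen) blast

text \<open>Spherical closeness becomes Euclidean closeness at every time when one of the two orbits
  is bounded by \<open>B\<close>; by symmetry either may be the bounded one.\<close>

lemma fatou_set_close_orbits:
  assumes z: "z \<in> fatou_set f" and B: "B \<ge> 0" and e: "e > 0"
  obtains r where "r > 0" "\<And>w n. w \<in> ball z r \<Longrightarrow>
    norm ((f ^^ n) z) \<le> B \<or> norm ((f ^^ n) w) \<le> B \<Longrightarrow> norm ((f ^^ n) z - (f ^^ n) w) < e"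
proof -
  obtain d where d: "d > 0" "\<And>x y. norm x \<le> B \<Longrightarrow> spherical_dist x y < d \<Longrightarrow> norm (x - y) < e"
    using spherical_dist_less_imp_close[OF B e] by blast
  obtain U where U: "open U" "z \<in> U" "spherically_equicontinuous_on U (\<lambda>n. f ^^ n)"
    using z unfolding fatou_set_def by blast
  obtain d' where d': "d' > 0" "\<And>w n. w \<in> U \<Longrightarrow> spherical_dist z w < d' \<Longrightarrow>
      spherical_dist ((f ^^ n) z) ((f ^^ n) w) < d"
    using U d(1) unfolding spherically_equicontinuous_on_def by meson
  obtain r1 where r1: "r1 > 0" "\<And>w. w \<in> ball z r1 \<Longrightarrow> spherical_dist z w < d'"
    using spherical_dist_tendsto_0[OF d'(1)] by blast
  obtain r2 where r2: "r2 > 0" "ball z r2 \<subseteq> U" using U openE by blast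
  show ?thesis
  proof (rule that[of "min r1 r2"])
    fix w n assume w: "w \<in> ball z (min r1 r2)"
      and or: "norm ((f ^^ n) z) \<le> B \<or> norm ((f ^^ n) w) \<le> B"
    have sd: "spherical_dist ((f ^^ n) z) ((f ^^ n) w) < d"
      using w r1(2)[of w] r2(2) by (intro d'(2)) auto
    then show "norm ((f ^^ n) z - (f ^^ n) w) < e"
      using or d(2)[of "(f ^^ n) z" "(f ^^ n) w"] d(2)[of "(f ^^ n) w" "(f ^^ n) z"]
      by (auto simp: spherical_dist_commute norm_minus_commute)
  qed (use r1 r2 in auto)
qed

subsection \<open>Lifting through an entire covering\<close>

locale entire_covering =
  fixes f :: "complex \<Rightarrow> complex" and S :: "complex set"
  assumes transcendental: "transcendental_entire f"
    and closed_S: "closed S" and bounded_S: "bounded S"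
    and covering: "covering_space (UNIV - f -` S) f (UNIV - S)"
begin

lemma holo: "f holomorphic_on X"
  using transcendental holomorphic_on_subset unfolding transcendental_entire_def by blast

lemma cont: "continuous_on X f"
  using holo holomorphic_on_imp_continuous_on by blast

lemma open_Compl_S: "open (UNIV - S)" "open (UNIV - f -` S)"
  using closed_S cont by (auto intro!: open_Diff closed_vimage)

lemma holo_funpow: "(f ^^ n) holomorphic_on X"
proof (induction n)
  case (Suc n)
  show ?case
    using holomorphic_on_compose_gen[OF Suc holo[of UNIV]] by (simp add: o_def)
qed (auto intro: holomorphic_intros)

lemma cont_funpow: "continuous_on X (f ^^ n)"
  using holo_funpow holomorphic_on_imp_continuous_on by blast

lemma has_deriv: "(f has_field_derivative deriv f z) (at z)"
  using holo[of UNIV] by (simp add: holomorphic_derivI)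

lemma deriv_funpow_Suc: "deriv (f ^^ Suc n) z = deriv f ((f ^^ n) z) * deriv (f ^^ n) z"
proof -
  have "((f ^^ n) has_field_derivative deriv (f ^^ n) z) (at z)"
    using holo_funpow[of n UNIV] by (simp add: holomorphic_derivI)
  then have "(f \<circ> (f ^^ n) has_field_derivative deriv f ((f ^^ n) z) * deriv (f ^^ n) z) (at z)"
    by (intro DERIV_chain has_deriv)
  then show ?thesis by (simp add: DERIV_imp_deriv)
qed

lemma not_constant: "\<not> f constant_on UNIV"
proof
  assume "f constant_on UNIV"
  then obtain c where "\<forall>z. f z = poly [:c:] z" by (auto simp: constant_on_def)
  then show False using transcendental unfolding transcendental_entire_def by blast
qed

lemma open_image: "open X \<Longrightarrow> open (f ` X)"
  by (rule open_mapping_thm[OF holo[of UNIV]]) (use not_constant in auto)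

lemma open_image_funpow: "open X \<Longrightarrow> open ((f ^^ n) ` X)"
proof (induction n)
  case (Suc n)
  have "(f ^^ Suc n) ` X = f ` ((f ^^ n) ` X)" by (simp add: image_comp)
  then show ?case using open_image Suc by metis
qed simp

text \<open>Convexity provides the simple connectivity needed to lift through the covering; the
  value \<open>w\<close> at \<open>x\<close> selects the inverse branch.\<close>

lemma holomorphic_lift:
  assumes h: "h holomorphic_on X" and X: "convex X" "x \<in> X"
    and avoid: "h ` X \<inter> S = {}" and w: "f w = h x"
  obtains k where "k holomorphic_on X" "k x = w" "\<And>y. y \<in> X \<Longrightarrow> f (k y) = h y"
proof -
  have hS: "h \<in> X \<rightarrow> UNIV - S" using avoid by blast
  then have wS: "w \<in> UNIV - f -` S" using X(2) w by auto
  obtain k where k: "continuous_on X k" "k \<in> X \<rightarrow> UNIV - f -` S" "k x = w"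
      "\<And>y. y \<in> X \<Longrightarrow> f (k y) = h y"
    using covering_space_lift_strong[OF covering wS X(2) convex_imp_simply_connected[OF X(1)]
        convex_imp_locally_path_connected[OF X(1)] holomorphic_on_imp_continuous_on[OF h] hS w[symmetric]]
    by blast
  have "k holomorphic_on X"
    by (rule covering_space_lift_is_holomorphic[OF covering open_Compl_S(2) holo h hS k(2,1,4)])
  then show ?thesis using that k by blast
qed

lemma lift_unique:
  assumes "continuous_on X k1" "continuous_on X k2" "connected X" "x \<in> X" "y \<in> X" "k1 x = k2 x"
    and "\<And>u. u \<in> X \<Longrightarrow> f (k1 u) = f (k2 u)" "\<And>u. u \<in> X \<Longrightarrow> f (k1 u) \<notin> S"
  shows "k1 y = k2 y"
  by (rule covering_space_lift_unique[OF covering, of k1 x k2 X "f \<circ> k1"])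
    (use assms in \<open>auto intro: continuous_on_compose2[OF cont[of UNIV]]\<close>)

text \<open>
  If \<open>E\<close> had a period, its values on a right half-plane would fill a punctured neighbourhood
  of infinity, so \<open>f\<close> would have a pole there.
\<close>

lemma exp_lift_periodic_imp_poly:
  assumes E: "E holomorphic_on {\<zeta>. Re \<zeta> > a}" "\<And>\<zeta>. Re \<zeta> > a \<Longrightarrow> f (E \<zeta>) = exp \<zeta>"
    and P: "P > 0" "\<And>\<zeta>. Re \<zeta> > a \<Longrightarrow> E (\<zeta> + \<i> * of_real P) = E \<zeta>"
  shows "\<exists>p. \<forall>z. f z = poly p z"
proof (rule entire_tendsto_infinity_imp_poly[OF holo], goal_cases)
  case (1 B)
  have nat_per: "E (\<zeta> + of_nat n * (\<i> * of_real P)) = E \<zeta>" if "Re \<zeta> > a" for \<zeta> n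
  proof (induction n)
    case (Suc n)
    have "E (\<zeta> + of_nat (Suc n) * (\<i> * of_real P)) = E ((\<zeta> + of_nat n * (\<i> * of_real P)) + \<i> * of_real P)"
      by (simp add: algebra_simps)
    also have "\<dots> = E \<zeta>" using P(2)[of "\<zeta> + of_nat n * (\<i> * of_real P)"] Suc that by simp
    finally show ?case .
  qed simp
  \<comment> \<open>Translation by whole periods confines the imaginary part to a compact
    interval.\<close>
  have reduce: "\<exists>\<zeta>'. Re \<zeta>' = Re \<zeta> \<and> 0 \<le> Im \<zeta>' \<and> Im \<zeta>' \<le> P \<and> E \<zeta>' = E \<zeta>" if \<zeta>: "Re \<zeta> > a" for \<zeta>
  proof -
    define n where "n = \<lfloor>Im \<zeta> / P\<rfloor>"
    define \<zeta>' where "\<zeta>' = \<zeta> - of_int n * (\<i> * of_real P)"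
    have "of_int n \<le> Im \<zeta> / P" "Im \<zeta> / P < of_int n + 1" unfolding n_def by linarith+
    then have n: "of_int n * P \<le> Im \<zeta>" "Im \<zeta> < (of_int n + 1) * P"
      using P(1) by (simp_all add: field_simps)
    have "E \<zeta>' = E \<zeta>"
    proof (cases "n \<ge> 0")
      case True
      then have "of_nat (nat n) = (of_int n :: complex)" by simp
      then have "\<zeta> = \<zeta>' + of_nat (nat n) * (\<i> * of_real P)" by (simp add: \<zeta>'_def)
      moreover have "Re \<zeta>' > a" using \<zeta> by (simp add: \<zeta>'_def)
      ultimately show ?thesis using nat_per[of \<zeta>' "nat n"] by metis
    next
      case False
      then have "of_nat (nat (- n)) = - (of_int n :: complex)" by simp
      then have "\<zeta>' = \<zeta> + of_nat (nat (- n)) * (\<i> * of_real P)" by (simp add: \<zeta>'_def)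
      then show ?thesis using nat_per[OF \<zeta>, of "nat (- n)"] by metis
    qed
    then show ?thesis using n by (intro exI[of _ \<zeta>']) (simp add: \<zeta>'_def algebra_simps)
  qed
  define b where "b = max (a + 1) (ln (\<bar>B\<bar> + 1))"
  have ab: "a < b" by (simp add: b_def)
  have "exp (ln (\<bar>B\<bar> + 1)) \<le> exp b" by (subst exp_le_cancel_iff) (simp add: b_def)
  then have "\<bar>B\<bar> + 1 \<le> exp b" by simp
  then have Bb: "B < exp b" by linarith
  define Q where "Q = {\<zeta>. Re \<zeta> > b}"
  have contE: "continuous_on X E" if "X \<subseteq> {\<zeta>. Re \<zeta> > a}" for X
    using holomorphic_on_imp_continuous_on[OF E(1)] continuous_on_subset that by blast
  have compE: "compact (E ` cbox (Complex b 0) (Complex c P))" for c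
    by (intro compact_continuous_image contE) (use ab in \<open>auto simp: in_cbox_complex_iff\<close>)
  have "bounded (E ` cbox (Complex b 0) (Complex b P))" using compE compact_imp_bounded by blast
  then obtain R where R: "R > 0" "\<And>\<zeta>. \<zeta> \<in> cbox (Complex b 0) (Complex b P) \<Longrightarrow> norm (E \<zeta>) \<le> R"
    unfolding bounded_pos by auto
  define \<Omega> where "\<Omega> = - cball (0::complex) R"
  have conn: "connected \<Omega>" unfolding \<Omega>_def
    by (rule connected_complement_bounded_convex) auto
  have "open (E ` Q)"
  proof (rule open_mapping_thm[of E "{\<zeta>. Re \<zeta> > a}"])
    show "\<not> E constant_on {\<zeta>. Re \<zeta> > a}"
    proof
      assume "E constant_on {\<zeta>. Re \<zeta> > a}"
      then obtain c where "\<And>\<zeta>. Re \<zeta> > a \<Longrightarrow> E \<zeta> = c" unfolding constant_on_def by blast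
      then have "exp (complex_of_real (a + 1)) = exp (complex_of_real (a + 2))"
        using E(2)[of "of_real (a + 1)"] E(2)[of "of_real (a + 2)"] by simp
      then have "norm (exp (complex_of_real (a + 1))) = norm (exp (complex_of_real (a + 2)))" by simp
      then show False by (simp add: norm_exp_eq_Re)
    qed
  qed (use ab E(1) in \<open>auto simp: Q_def open_halfspace_Re_gt convex_halfspace_Re_gt intro: convex_connected\<close>)
  then have 1: "openin (top_of_set \<Omega>) (E ` Q \<inter> \<Omega>)" by (auto simp: openin_open)
  have cl: "w \<in> E ` Q" if w: "w \<in> \<Omega>" "w \<in> closure (E ` Q)" for w
  proof -
    have "compact (f ` cball w 1)" by (intro compact_continuous_image cont) auto
    then obtain C where C: "C > 0" "\<And>y. y \<in> cball w 1 \<Longrightarrow> norm (f y) \<le> C"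
      by (auto dest!: compact_imp_bounded simp: bounded_pos)
    \<comment> \<open>Near \<open>w\<close> the function \<open>f\<close> is bounded, which bounds
      \<open>Re \<zeta>\<close> above; with \<open>reduce\<close> this traps preimages in a compact
      rectangle.\<close>
    have "E ` Q \<inter> ball w 1 \<subseteq> E ` cbox (Complex b 0) (Complex (ln C) P)"
    proof
      fix y assume y: "y \<in> E ` Q \<inter> ball w 1"
      then obtain \<zeta> where \<zeta>: "y = E \<zeta>" "Re \<zeta> > b" by (auto simp: Q_def)
      then obtain \<zeta>' where \<zeta>': "Re \<zeta>' = Re \<zeta>" "0 \<le> Im \<zeta>'" "Im \<zeta>' \<le> P" "E \<zeta>' = y"
        using reduce[of \<zeta>] ab by auto
      have "exp (Re \<zeta>) \<le> C" using C(2)[of y] E(2)[of \<zeta>] \<zeta> y ab by simp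
      then have "Re \<zeta> \<le> ln C" using C(1) by (simp add: ln_ge_iff)
      then show "y \<in> E ` cbox (Complex b 0) (Complex (ln C) P)"
        using \<zeta> \<zeta>' by (intro image_eqI[of _ _ \<zeta>']) (auto simp: in_cbox_complex_iff)
    qed
    then have "closure (E ` Q \<inter> ball w 1) \<subseteq> E ` cbox (Complex b 0) (Complex (ln C) P)"
      using compE compact_imp_closed closure_minimal by blast
    moreover have "w \<in> closure (E ` Q \<inter> ball w 1)"
      using open_Int_closure_subset[of "ball w 1" "E ` Q"] w(2) by (auto simp: Int_commute)
    ultimately obtain \<zeta> where \<zeta>: "w = E \<zeta>" "\<zeta> \<in> cbox (Complex b 0) (Complex (ln C) P)" by blast
    have "Re \<zeta> \<noteq> b"
    proof
      assume "Re \<zeta> = b"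
      then have "norm (E \<zeta>) \<le> R" using \<zeta>(2) by (intro R(2)) (auto simp: in_cbox_complex_iff)
      then show False using w(1) \<zeta>(1) by (simp add: \<Omega>_def)
    qed
    then show ?thesis using \<zeta> by (auto simp: Q_def in_cbox_complex_iff)
  qed
  have 2: "closedin (top_of_set \<Omega>) (E ` Q \<inter> \<Omega>)"
    unfolding closedin_closed
    by (intro exI[of _ "closure (E ` Q)"]) (use cl closure_subset in blast)
  have "E ` Q \<inter> \<Omega> \<noteq> {}"
  proof -
    have "compact (f ` cball 0 R)" by (intro compact_continuous_image cont) auto
    then obtain C where C: "C > 0" "\<And>y. y \<in> cball 0 R \<Longrightarrow> norm (f y) \<le> C"
      by (auto dest!: compact_imp_bounded simp: bounded_pos)
    define t where "t = max b (ln C) + 1"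
    have "ln C < t" by (simp add: t_def)
    then have "exp (ln C) < exp t" by (subst exp_less_cancel_iff)
    then have "C < exp t" using C(1) by simp
    then have "norm (f (E (of_real t))) > C" using E(2)[of "of_real t"] ab by (simp add: t_def)
    then have "E (of_real t) \<in> \<Omega>" unfolding \<Omega>_def using C(2) by (meson ComplI not_le)
    moreover have "E (of_real t) \<in> E ` Q" by (simp add: Q_def t_def)
    ultimately show ?thesis by blast
  qed
  then have "E ` Q \<inter> \<Omega> = \<Omega>" using conn 1 2 unfolding connected_clopen by blast
  then have "\<Omega> \<subseteq> E ` Q" by blast
  show ?case
  proof (intro exI allI impI)
    fix z :: complex assume "norm z > R"
    then have "z \<in> E ` Q" using \<open>\<Omega> \<subseteq> E ` Q\<close> by (auto simp: \<Omega>_def)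
    then obtain \<zeta> where "z = E \<zeta>" "Re \<zeta> > b" by (auto simp: Q_def)
    then show "norm (f z) > B" using E(2)[of \<zeta>] ab Bb by (simp add: less_trans[of B "exp b"])
  qed
qed

text \<open>Points with the same image under \<open>E\<close> have equal exponentials. Uniqueness of
  lifts turns their difference, a multiple of 2 pi i, into a period of \<open>E\<close>, which
  transcendence excludes.\<close>

lemma exp_lift_inj:
  assumes S: "S \<subseteq> cball 0 (exp a)"
    and E: "E holomorphic_on {\<zeta>. Re \<zeta> > a}" "\<And>\<zeta>. Re \<zeta> > a \<Longrightarrow> f (E \<zeta>) = exp \<zeta>"
  shows "inj_on E {\<zeta>. Re \<zeta> > a}"
proof (rule inj_onI, rule ccontr)
  fix x y assume xy: "x \<in> {\<zeta>. Re \<zeta> > a}" "y \<in> {\<zeta>. Re \<zeta> > a}" "E x = E y" "x \<noteq> y"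
  have *: False if xy: "Re x > a" "Re y > a" "E x = E y" and n: "n > (0::int)"
    and eq: "x = y + (of_int (2 * n) * pi) * \<i>" for x y n
  proof -
    define P where "P = real_of_int (2 * n) * pi"
    have x: "x = y + \<i> * of_real P" unfolding eq P_def by simp
    have "E (\<zeta> + \<i> * of_real P) = E \<zeta>" if "Re \<zeta> > a" for \<zeta>
    proof (rule lift_unique[of "{\<zeta>. Re \<zeta> > a}" "\<lambda>\<zeta>. E (\<zeta> + \<i> * of_real P)" E y \<zeta>])
      have "(\<lambda>\<zeta>. E (\<zeta> + \<i> * of_real P)) holomorphic_on {\<zeta>. Re \<zeta> > a}"
        by (rule holomorphic_on_compose_gen[OF _ E(1), unfolded o_def]) (auto intro!: holomorphic_intros)
      then show "continuous_on {\<zeta>. Re \<zeta> > a} (\<lambda>\<zeta>. E (\<zeta> + \<i> * of_real P))"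
        by (rule holomorphic_on_imp_continuous_on)
      show "continuous_on {\<zeta>. Re \<zeta> > a} E" using E(1) by (rule holomorphic_on_imp_continuous_on)
      show "E (y + \<i> * of_real P) = E y" using xy x by simp
      fix u :: complex assume u: "u \<in> {\<zeta>. Re \<zeta> > a}"
      have "exp (u + \<i> * of_real P) = exp u"
        unfolding exp_eq by (intro exI[of _ n]) (simp add: P_def)
      then show "f (E (u + \<i> * of_real P)) = f (E u)" using E(2) u by simp
      show "f (E (u + \<i> * of_real P)) \<notin> S"
      proof
        assume "f (E (u + \<i> * of_real P)) \<in> S"
        then have "norm (exp (u + \<i> * of_real P)) \<le> exp a" using E(2) u S by force
        then show False using u by simp
      qed
    qed (use xy that in \<open>auto simp: convex_halfspace_Re_gt intro: convex_connected\<close>)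
    then have "\<exists>p. \<forall>z. f z = poly p z"
      by (intro exp_lift_periodic_imp_poly[OF E, of P]) (use n in \<open>auto simp: P_def\<close>)
    then show False using transcendental unfolding transcendental_entire_def by blast
  qed
  have "exp x = exp y" using xy E(2)[of x] E(2)[of y] by simp
  then obtain n :: int where n: "x = y + (of_int (2 * n) * pi) * \<i>" unfolding exp_eq by blast
  consider "n > 0" | "n = 0" | "n < 0" by linarith
  then show False
  proof cases
    case 1
    show False by (rule *[OF _ _ _ 1 n]) (use xy in auto)
  next
    case 2
    then have "x = y" using n by simp
    then show False using xy(4) by contradiction
  next
    case 3
    then have "- n > 0" by simp
    moreover have "y = x + (of_int (2 * - n) * pi) * \<i>" unfolding n by simp
    ultimately show False by (rule *[rotated 3]) (use xy in auto)
  qed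
qed

text \<open>\<open>E\<close> is an inverse branch of \<open>f\<close> in logarithmic coordinates.
  The bound on \<open>f 0\<close> keeps 0 out of its image, and its injectivity then supplies
  \<open>K\<close>.\<close>

lemma exp_lift_exists:
  assumes S: "S \<subseteq> cball 0 (exp a)" and f0: "norm (f 0) \<le> exp a" and z: "norm (f z) > exp a"
  obtains E K where "E holomorphic_on {\<zeta>. Re \<zeta> > a}" "\<And>\<zeta>. Re \<zeta> > a \<Longrightarrow> f (E \<zeta>) = exp \<zeta>"
    "Re (Ln (f z)) > a" "E (Ln (f z)) = z" "connected K" "\<not> bounded K" "0 \<in> K" "E ` {\<zeta>. Re \<zeta> > a} \<inter> K = {}"
proof -
  let ?H = "{\<zeta>. Re \<zeta> > a}"
  have fz: "f z \<noteq> 0" using z by (auto simp: not_less)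
  have Re: "Re (Ln (f z)) > a"
    using z fz by (simp add: exp_less_cancel_iff[of a "ln (norm (f z))", symmetric] del: exp_less_cancel_iff)
  have notS: "exp ` ?H \<inter> S = {}"
  proof -
    have "exp \<zeta> \<notin> S" if "Re \<zeta> > a" for \<zeta>
    proof
      assume "exp \<zeta> \<in> S"
      then have "norm (exp \<zeta>) \<le> exp a" using S by force
      then show False using that by simp
    qed
    then show ?thesis by blast
  qed
  obtain E where E: "E holomorphic_on ?H" "E (Ln (f z)) = z" "\<And>\<zeta>. \<zeta> \<in> ?H \<Longrightarrow> f (E \<zeta>) = exp \<zeta>"
    by (rule holomorphic_lift[of exp ?H "Ln (f z)" z])
      (use Re fz notS in \<open>auto intro: holomorphic_intros simp: convex_halfspace_Re_gt\<close>)
  have inj: "inj_on E ?H" using exp_lift_inj[OF S E(1)] E(3) by simp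
  have "0 \<notin> E ` ?H"
  proof
    assume "0 \<in> E ` ?H"
    then obtain \<zeta> where "Re \<zeta> > a" "f 0 = exp \<zeta>" using E(3) by force
    then show False using f0 by simp
  qed
  then obtain K where K: "connected K" "\<not> bounded K" "0 \<in> K" "E ` ?H \<inter> K = {}"
    using injective_image_omitted_continuum[OF open_halfspace_Re_gt convex_halfspace_Re_gt _ E(1) inj]
      Re by (metis (mono_tags) empty_iff mem_Collect_eq)
  have "f (E \<zeta>) = exp \<zeta>" if "Re \<zeta> > a" for \<zeta> by (rule E(3)) (simp add: that)
  then show ?thesis by (rule that[OF E(1) _ Re E(2) K])
qed

text \<open>The Eremenko-Lyubich expansion estimate: omission of \<open>K\<close> bounds the
  derivative of \<open>E\<close> on the largest disc about \<open>Ln (f z)\<close> in the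
  half-plane, and differentiating \<open>f (E \<zeta>) = exp \<zeta>\<close> transfers this to
  \<open>f\<close>.\<close>

lemma log_derivative_bound:
  assumes S: "S \<subseteq> cball 0 (exp a)" and f0: "norm (f 0) \<le> exp a" and z: "norm (f z) > exp a"
  shows "norm (f z) * (ln (norm (f z)) - a) \<le> 2 * distortion_const * norm z * norm (deriv f z)"
proof -
  let ?H = "{\<zeta>. Re \<zeta> > a}" and ?\<zeta> = "Ln (f z)"
  obtain E K where E: "E holomorphic_on ?H" "\<And>\<zeta>. Re \<zeta> > a \<Longrightarrow> f (E \<zeta>) = exp \<zeta>" "Re ?\<zeta> > a" "E ?\<zeta> = z"
    and K: "connected K" "\<not> bounded K" "0 \<in> K" "E ` ?H \<inter> K = {}"
    by (rule exp_lift_exists[OF assms]) (rule that)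
  have fz: "f z \<noteq> 0" using z by (auto simp: not_less)
  define r where "r = Re ?\<zeta> - a"
  have r: "r > 0" "r = ln (norm (f z)) - a" using E(3) fz by (simp_all add: r_def)
  have sub: "ball ?\<zeta> r \<subseteq> ?H"
  proof
    fix u assume "u \<in> ball ?\<zeta> r"
    then have "\<bar>Re (?\<zeta> - u)\<bar> < r" using abs_Re_le_cmod[of "?\<zeta> - u"] by (simp add: dist_norm)
    then show "u \<in> ?H" by (simp add: r_def)
  qed
  have "norm (deriv E ?\<zeta>) \<le> 2 * distortion_const * norm (E ?\<zeta> - 0) / r"
    by (rule omitted_continuum_deriv_bound[OF holomorphic_on_subset[OF E(1) sub] r(1) K(1-3)])
      (use K(4) sub in blast)
  then have dE: "norm (deriv E ?\<zeta>) * r \<le> 2 * distortion_const * norm z"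
    using r(1) E(4) by (simp add: pos_le_divide_eq)
  have "(f \<circ> E has_field_derivative deriv f (E ?\<zeta>) * deriv E ?\<zeta>) (at ?\<zeta>)"
    by (intro DERIV_chain has_deriv holomorphic_derivI[OF E(1)]) (use E(3) in \<open>auto simp: open_halfspace_Re_gt\<close>)
  then have "(exp has_field_derivative deriv f (E ?\<zeta>) * deriv E ?\<zeta>) (at ?\<zeta>)"
    by (rule has_field_derivative_transform_within[where d = r])
      (use r sub E(2) in \<open>auto simp: dist_commute subset_iff\<close>)
  then have "deriv f z * deriv E ?\<zeta> = f z"
    using DERIV_exp[of ?\<zeta>] DERIV_unique fz E(4) by fastforce
  then have "norm (f z) * r = norm (deriv f z) * (norm (deriv E ?\<zeta>) * r)"
    by (metis norm_mult mult.assoc)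
  also have "\<dots> \<le> norm (deriv f z) * (2 * distortion_const * norm z)"
    by (intro mult_left_mono dE) simp
  finally show ?thesis using r(2) by (simp add: ac_simps)
qed

end

subsection \<open>Orbits in the Fatou set are not escaping\<close>

text \<open>Some logarithm of \<open>q\<close> lies within pi of \<open>b\<close>; the radius 7
  leaves ample room.\<close>

lemma log_branch_on_circle:
  fixes q :: complex
  assumes "norm q = exp (Re b)"
  obtains \<omega> where "exp \<omega> = q" "norm (\<omega> - b) < 7"
proof -
  have q: "q \<noteq> 0" using assms by auto
  define u where "u = q / exp b"
  have u: "u \<noteq> 0" "norm u = 1" using assms q by (simp_all add: u_def norm_divide)
  then have "Re (Ln u) = 0" by simp
  then have "norm (Ln u) = \<bar>Im (Ln u)\<bar>" by (simp add: cmod_def)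
  moreover have "\<bar>Im (Ln u)\<bar> \<le> pi" using mpi_less_Im_Ln[OF u(1)] Im_Ln_le_pi[OF u(1)] by linarith
  ultimately have "norm (Ln u) < 7" using pi_less_4 by linarith
  moreover have "exp (b + Ln u) = q" using u by (simp add: exp_add) (simp add: u_def)
  ultimately show ?thesis using that[of "b + Ln u"] by simp
qed

context entire_covering
begin

text \<open>This is expansion in the metric \<open>|dz|/|z|\<close>. The margin
  \<open>4 * distortion_const\<close> is what makes \<open>log_derivative_bound\<close> give a
  factor 2 at each step.\<close>

lemma deriv_funpow_lower_bound:
  assumes S: "S \<subseteq> cball 0 (exp a)" and f0: "norm (f 0) \<le> exp a"
    and z: "\<And>n. norm ((f ^^ n) z) \<ge> exp (a + 4 * distortion_const)"
  shows "2 ^ n * norm ((f ^^ n) z) \<le> norm z * norm (deriv (f ^^ n) z)"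
proof (induction n)
  case 0
  have "deriv (\<lambda>x. x) z = 1" by simp
  then show ?case by (simp add: id_def)
next
  case (Suc n)
  let ?x = "(f ^^ n) z"
  have fx: "norm (f ?x) \<ge> exp (a + 4 * distortion_const)" using z[of "Suc n"] by simp
  have M: "distortion_const > 1" by (rule distortion_const_gt_1)
  have "exp a < exp (a + 4 * distortion_const)" using M by simp
  then have fa: "norm (f ?x) > exp a" using fx by linarith
  have "ln (norm (f ?x)) \<ge> a + 4 * distortion_const"
    using fx by (subst ln_ge_iff) (auto intro: less_le_trans[OF exp_gt_zero])
  then have "norm (f ?x) * (4 * distortion_const) \<le> norm (f ?x) * (ln (norm (f ?x)) - a)"
    by (intro mult_left_mono) auto
  also have "\<dots> \<le> 2 * distortion_const * norm ?x * norm (deriv f ?x)"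
    by (rule log_derivative_bound[OF S f0 fa])
  finally have "(2 * distortion_const) * (2 * norm (f ?x)) \<le> (2 * distortion_const) * (norm ?x * norm (deriv f ?x))"
    by (simp add: ac_simps)
  then have step: "2 * norm (f ?x) \<le> norm ?x * norm (deriv f ?x)"
    using M by (subst (asm) mult_le_cancel_left_pos) auto
  have "2 ^ Suc n * norm ((f ^^ Suc n) z) = 2 ^ n * (2 * norm (f ?x))" by simp
  also have "\<dots> \<le> 2 ^ n * (norm ?x * norm (deriv f ?x))" by (intro mult_left_mono step) auto
  also have "\<dots> = (2 ^ n * norm ?x) * norm (deriv f ?x)" by simp
  also have "\<dots> \<le> (norm z * norm (deriv (f ^^ n) z)) * norm (deriv f ?x)"
    by (intro mult_right_mono Suc.IH) auto
  also have "\<dots> = norm z * norm (deriv (f ^^ Suc n) z)"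
    by (simp add: deriv_funpow_Suc norm_mult ac_simps del: funpow.simps)
  finally show ?case .
qed

text \<open>
  This is the argument of Eremenko and Lyubich: if all iterates were large on a disc, the
  expansion would make a branch of \<open>log (f ^^ n)\<close> cover a disc of radius 7, so the image of
  the disc under \<open>f ^^ n\<close> would contain a circle about 0, whereas it lies in a simply connected
  tract that omits 0.
\<close>

lemma no_uniformly_large_orbits:
  obtains R where "\<And>X N. open X \<Longrightarrow> X \<noteq> {} \<Longrightarrow> \<exists>n\<ge>N. \<exists>w\<in>X. norm ((f ^^ n) w) \<le> R"
proof -
  obtain b0 where b0: "b0 > 0" "S \<subseteq> cball 0 b0"
    using bounded_subset_ballD[OF bounded_S, of 0] ball_subset_cball by blast
  define a where "a = ln (max b0 (norm (f 0)))"
  have ea: "exp a = max b0 (norm (f 0))" using b0 by (simp add: a_def)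
  have S: "S \<subseteq> cball 0 (exp a)" using b0(2) by (auto simp: ea)
  have f0: "norm (f 0) \<le> exp a" by (simp add: ea)
  define R where "R = exp (a + 4 * distortion_const)"
  have aR: "exp a < R" using distortion_const_gt_1 by (simp add: R_def)
  have "\<exists>n\<ge>N. \<exists>w\<in>X. norm ((f ^^ n) w) \<le> R" if X: "open X" "X \<noteq> {}" for X N
  proof (rule ccontr)
    assume neg: "\<not> ?thesis"
    define Y where "Y = (f ^^ N) ` X"
    have large: "norm ((f ^^ n) w) > R" if wY: "w \<in> Y" for w n
    proof -
      obtain x where "x \<in> X" "w = (f ^^ N) x" using wY by (auto simp: Y_def)
      moreover have "(f ^^ n) ((f ^^ N) x) = (f ^^ (n + N)) x" by (simp add: funpow_add)
      moreover have "n + N \<ge> N" by simp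
      ultimately show ?thesis using neg by (metis not_le)
    qed
    have "open Y" "Y \<noteq> {}" using X open_image_funpow by (auto simp: Y_def)
    then obtain z r where zr: "r > 0" "ball z r \<subseteq> Y" by (metis ex_in_conv openE)
    have z: "z \<in> Y" using zr by auto
    have large': "norm ((f ^^ n) w) > R" if "w \<in> ball z r" for n w
      using that zr(2) by (intro large) blast
    have R0: "R > 0" by (simp add: R_def)
    have nz: "(f ^^ n) w \<noteq> 0" if "w \<in> ball z r" for n w
      using large'[OF that, of n] R0 by auto
    have z0: "norm z > 0" using nz[of z 0] zr by simp
    \<comment> \<open>Here 84 is 7 times the constant 12 of Bloch's theorem.\<close>
    obtain n :: nat where n: "84 * norm z / r < 2 ^ n" using real_arch_pow[of 2] by auto
    have contr: "contractible (ball z r)" by (rule convex_imp_contractible[OF convex_ball])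
    obtain g where g: "g holomorphic_on ball z r" "\<And>w. w \<in> ball z r \<Longrightarrow> (f ^^ n) w = exp (g w)"
      by (rule contractible_imp_holomorphic_log[OF holo_funpow[of n] contr]) (use nz in blast)+
    have "(exp \<circ> g has_field_derivative exp (g z) * deriv g z) (at z)"
      by (intro DERIV_chain DERIV_exp holomorphic_derivI[OF g(1)]) (use zr in auto)
    then have "((f ^^ n) has_field_derivative exp (g z) * deriv g z) (at z)"
      by (rule has_field_derivative_transform_within[where d = r]) (use zr g in \<open>auto simp: dist_commute\<close>)
    then have "deriv (f ^^ n) z = (f ^^ n) z * deriv g z"
      using g(2)[of z] zr(1) by (simp add: DERIV_imp_deriv)
    then have "2 ^ n * norm ((f ^^ n) z) \<le> norm z * (norm ((f ^^ n) z) * norm (deriv g z))"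
      using deriv_funpow_lower_bound[OF S f0, of z n] large[OF z] by (simp add: R_def norm_mult less_imp_le)
    then have "norm ((f ^^ n) z) * 2 ^ n \<le> norm ((f ^^ n) z) * (norm z * norm (deriv g z))"
      by (simp add: ac_simps)
    moreover have "norm ((f ^^ n) z) > 0" using nz[of z n] zr by simp
    ultimately have "2 ^ n \<le> norm z * norm (deriv g z)" by (subst (asm) mult_le_cancel_left_pos)
    then have "84 * norm z / r < norm z * norm (deriv g z)" using n by linarith
    then have "norm z * 84 < norm z * (r * norm (deriv g z))" using zr(1) by (simp add: field_simps)
    then have "7 \<le> r * norm (deriv g z) / 12" using z0 by (subst (asm) mult_less_cancel_left_pos) auto
    then obtain b where b: "ball b 7 \<subseteq> g ` ball z r" using Bloch[OF g(1) zr(1)] by blast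
    have fz: "norm (f ((f ^^ n) z)) > exp a" using large[OF z, of "Suc n"] aR by simp
    obtain E K where E: "E holomorphic_on {\<zeta>. Re \<zeta> > a}" "\<And>\<zeta>. Re \<zeta> > a \<Longrightarrow> f (E \<zeta>) = exp \<zeta>"
      "Re (Ln (f ((f ^^ n) z))) > a" "E (Ln (f ((f ^^ n) z))) = (f ^^ n) z"
      and K: "connected K" "\<not> bounded K" "0 \<in> K" "E ` {\<zeta>. Re \<zeta> > a} \<inter> K = {}"
      by (rule exp_lift_exists[OF S f0 fz]) (rule that)
    obtain g1 where g1: "g1 holomorphic_on ball z r" "\<And>w. w \<in> ball z r \<Longrightarrow> (f ^^ Suc n) w = exp (g1 w)"
      by (rule contractible_imp_holomorphic_log[OF holo_funpow[of "Suc n"] contr]) (use nz in blast)+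
    \<comment> \<open>The shift makes \<open>G z\<close> the principal logarithm, where
      \<open>E\<close> returns \<open>(f ^^ n) z\<close>; uniqueness of lifts then identifies
      \<open>f ^^ n\<close> with \<open>E\<close> after \<open>G\<close>.\<close>
    define G where "G w = g1 w + (Ln (f ((f ^^ n) z)) - g1 z)" for w
    have G: "G holomorphic_on ball z r" unfolding G_def by (intro holomorphic_intros g1)
    have expG: "exp (G w) = f ((f ^^ n) w)" if "w \<in> ball z r" for w
    proof -
      have "f ((f ^^ n) z) \<noteq> 0" using nz[of z "Suc n"] zr by simp
      then show ?thesis
        using g1(2)[OF that] g1(2)[of z] zr(1) by (simp add: G_def exp_add exp_diff)
    qed
    have ReG: "Re (G w) > a" if "w \<in> ball z r" for w
    proof -
      have "exp a < norm (exp (G w))"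
        using large'[OF that, of "Suc n"] aR unfolding expG[OF that] by simp
      then show ?thesis by simp
    qed
    have tract: "(f ^^ n) w = E (G w)" if "w \<in> ball z r" for w
    proof (rule lift_unique[of "ball z r" "f ^^ n" "\<lambda>w. E (G w)" z w])
      have "(\<lambda>w. E (G w)) holomorphic_on ball z r"
        by (rule holomorphic_on_compose_gen[OF G E(1), unfolded o_def]) (use ReG in auto)
      then show "continuous_on (ball z r) (\<lambda>w. E (G w))" by (rule holomorphic_on_imp_continuous_on)
      show "(f ^^ n) z = E (G z)" using E(4) by (simp add: G_def)
      show "f ((f ^^ n) u) = f (E (G u))" if "u \<in> ball z r" for u
        using E(2)[OF ReG[OF that]] expG[OF that] by simp
      show "f ((f ^^ n) u) \<notin> S" if "u \<in> ball z r" for u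
        using large'[OF that, of "Suc n"] aR S by (auto simp: subset_iff)
    qed (use that zr cont_funpow in auto)
    \<comment> \<open>This \<open>q\<close> has a logarithm in \<open>ball b 7\<close>, so it is a
      value of \<open>f ^^ n\<close> on the disc, although \<open>E\<close> omits
      \<open>K\<close>.\<close>
    obtain q where q: "q \<in> K" "norm (q - 0) = exp (Re b)"
      using connected_unbounded_meets_sphere[OF K(1-3), of "exp (Re b)"] by auto
    obtain \<omega> where \<omega>: "exp \<omega> = q" "norm (\<omega> - b) < 7" using log_branch_on_circle[of q b] q(2) by auto
    then have "\<omega> \<in> g ` ball z r" using b by (auto simp: dist_norm norm_minus_commute subset_iff)
    then obtain w where w: "w \<in> ball z r" "\<omega> = g w" by blast
    then have "q = E (G w)" using tract[OF w(1)] g(2)[OF w(1)] \<omega>(1) by simp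
    then show False using K(4) q(1) ReG[OF w(1)] by blast
  qed
  then show ?thesis using that by blast
qed

text \<open>Near \<open>z\<close> there are points with images bounded by \<open>R\<close> at
  arbitrarily late times, and equicontinuity keeps the orbit of \<open>z\<close> within 1 of them at
  those times.\<close>

lemma fatou_set_not_escaping:
  obtains B where "\<And>z N. z \<in> fatou_set f \<Longrightarrow> \<exists>n\<ge>N. norm ((f ^^ n) z) \<le> B"
proof -
  obtain R where R: "\<And>X N. open X \<Longrightarrow> X \<noteq> {} \<Longrightarrow> \<exists>n\<ge>N. \<exists>w\<in>X. norm ((f ^^ n) w) \<le> R"
    using no_uniformly_large_orbits by blast
  have "\<exists>n\<ge>N. norm ((f ^^ n) z) \<le> max R 0 + 1" if z: "z \<in> fatou_set f" for z N
  proof -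
    obtain r where r: "r > 0" "\<And>w n. w \<in> ball z r \<Longrightarrow>
        norm ((f ^^ n) z) \<le> max R 0 \<or> norm ((f ^^ n) w) \<le> max R 0 \<Longrightarrow> norm ((f ^^ n) z - (f ^^ n) w) < 1"
      using fatou_set_close_orbits[OF z, of "max R 0" 1] by auto
    obtain n w where nw: "n \<ge> N" "w \<in> ball z r" "norm ((f ^^ n) w) \<le> R"
      using R[of "ball z r" N] r(1) by auto
    then have "norm ((f ^^ n) z - (f ^^ n) w) < 1" by (intro r(2)) auto
    then have "norm ((f ^^ n) z) \<le> max R 0 + 1"
      using nw(3) norm_triangle_sub[of "(f ^^ n) z" "(f ^^ n) w"] by simp
    then show ?thesis using nw(1) by blast
  qed
  then show ?thesis using that by blast
qed

text \<open>
  By Bloch's theorem a large derivative at a bounded time produces a disc of definite size in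
  \<open>(f ^^ n) ` W\<close>; infinitely many pairwise disjoint such discs do not fit into a bounded set.
\<close>

lemma wandering_domain_deriv_small:
  assumes W: "wandering_domain f W" "z \<in> W" and \<eta>: "\<eta> > 0"
  obtains N where "\<And>n. n \<ge> N \<Longrightarrow> norm ((f ^^ n) z) \<le> B \<Longrightarrow> norm (deriv (f ^^ n) z) < \<eta>"
proof (rule ccontr)
  assume "\<not> thesis"
  then have neg: "\<forall>N. \<exists>n\<ge>N. norm ((f ^^ n) z) \<le> B \<and> norm (deriv (f ^^ n) z) \<ge> \<eta>"
    using that not_le by metis
  define I where "I = {n. norm ((f ^^ n) z) \<le> B \<and> norm (deriv (f ^^ n) z) \<ge> \<eta>}"
  have infI: "infinite I" unfolding I_def infinite_nat_iff_unbounded_le using neg by blast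
  have comp: "W \<in> components (fatou_set f)"
    and disj: "\<And>n m. n \<noteq> m \<Longrightarrow> (f ^^ n) ` W \<inter> (f ^^ m) ` W = {}"
    using W(1) unfolding wandering_domain_def by blast+
  have zF: "z \<in> fatou_set f" using comp W(2) in_components_subset by blast
  obtain r1 where r1: "r1 > 0" "\<And>w n. w \<in> ball z r1 \<Longrightarrow>
      norm ((f ^^ n) z) \<le> max B 0 \<or> norm ((f ^^ n) w) \<le> max B 0 \<Longrightarrow> norm ((f ^^ n) z - (f ^^ n) w) < 1"
    using fatou_set_close_orbits[OF zF, of "max B 0" 1] by auto
  have "open W" using comp open_fatou_set open_components by blast
  then obtain r2 where r2: "r2 > 0" "ball z r2 \<subseteq> W" using W(2) openE by blast
  define r where "r = min r1 r2"
  have r: "r > 0" using r1 r2 by (simp add: r_def)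
  define \<rho> where "\<rho> = r * \<eta> / 12"
  have \<rho>: "\<rho> > 0" using r \<eta> by (simp add: \<rho>_def)
  have "\<exists>b. ball b \<rho> \<subseteq> (f ^^ n) ` ball z r" if "n \<in> I" for n
  proof -
    have "\<rho> \<le> r * norm (deriv (f ^^ n) z) / 12" using that r by (simp add: I_def \<rho>_def)
    then show ?thesis using Bloch[OF holo_funpow r] by blast
  qed
  then obtain b where b: "\<And>n. n \<in> I \<Longrightarrow> ball (b n) \<rho> \<subseteq> (f ^^ n) ` ball z r" by metis
  have bin: "b n \<in> (f ^^ n) ` ball z r" if "n \<in> I" for n using b[OF that] \<rho> by auto
  have bb: "b n \<in> cball 0 (max B 0 + 1)" if n: "n \<in> I" for n
  proof -
    obtain w where w: "w \<in> ball z r" "b n = (f ^^ n) w" using bin[OF n] by blast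
    have "norm ((f ^^ n) z) \<le> max B 0" using n by (auto simp: I_def)
    moreover from this have "norm ((f ^^ n) z - (f ^^ n) w) < 1" using w by (intro r1(2)) (auto simp: r_def)
    ultimately show ?thesis
      using w(2) norm_triangle_sub[of "(f ^^ n) w" "(f ^^ n) z"] by (simp add: norm_minus_commute)
  qed
  \<comment> \<open>A closer centre would lie in two of the disjoint images of
    \<open>W\<close>.\<close>
  have sep: "\<rho> \<le> dist (b n) (b m)" if nm: "n \<in> I" "m \<in> I" "n \<noteq> m" for n m
  proof (rule ccontr)
    assume "\<not> ?thesis"
    then have "b m \<in> ball (b n) \<rho>" by simp
    then have "b m \<in> (f ^^ n) ` ball z r" using b[OF nm(1)] by blast
    then have "b m \<in> (f ^^ n) ` W \<inter> (f ^^ m) ` W" using bin[OF nm(2)] r2(2) by (auto simp: r_def)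
    then show False using disj nm(3) by blast
  qed
  have "inj_on b I"
  proof (rule inj_onI, rule ccontr)
    fix n m assume "n \<in> I" "m \<in> I" "b n = b m" "n \<noteq> m"
    then show False using sep[of n m] \<rho> by simp
  qed
  then have "infinite (b ` I)" using infI finite_imageD by blast
  moreover have "b ` I \<subseteq> cball 0 (max B 0 + 1)" using bb by blast
  ultimately obtain x where "x islimpt (b ` I)"
    using Heine_Borel_imp_Bolzano_Weierstrass[OF compact_cball] by blast
  then have inf: "infinite (b ` I \<inter> ball x (\<rho>/2))" using \<rho> by (simp add: islimpt_eq_infinite_ball)
  then obtain u where u: "u \<in> b ` I \<inter> ball x (\<rho>/2)" by (metis ex_in_conv finite.emptyI)
  have "infinite (b ` I \<inter> ball x (\<rho>/2) - {u})" using inf by simp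
  then obtain v where v: "v \<in> b ` I \<inter> ball x (\<rho>/2) - {u}" by (metis ex_in_conv finite.emptyI)
  have "dist u v < \<rho>" using u v dist_triangle[of u v x] by (simp add: dist_commute)
  moreover obtain n m where "n \<in> I" "m \<in> I" "u = b n" "v = b m" using u v by blast
  ultimately show False using sep[of n m] v by force
qed

subsection \<open>Pulling back along orbits in wandering domains\<close>

text \<open>\<open>f ^^ i\<close> agrees at \<open>p\<close> and \<open>q\<close> and inverts
  \<open>h\<close>, so \<open>h\<close> is injective and cannot take both values.\<close>

lemma pullback_omits_fibre_point:
  assumes h: "h holomorphic_on ball x r" and r: "r > 0"
    and inv: "\<And>y. y \<in> ball x r \<Longrightarrow> (f ^^ i) (h y) = y" and i: "i > 0"
    and pq: "p \<noteq> q" "f p = f q"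
  obtains c K where "c = p \<or> c = q" "connected K" "\<not> bounded K" "c \<in> K" "h ` ball x r \<inter> K = {}"
proof -
  have inj: "inj_on h (ball x r)" by (rule inj_on_inverseI[of _ "f ^^ i"]) (rule inv)
  have "(f ^^ i) p = (f ^^ i) q"
    using i pq(2) by (cases i) (auto simp: funpow_Suc_right simp del: funpow.simps)
  have "p \<notin> h ` ball x r \<or> q \<notin> h ` ball x r"
  proof (rule ccontr)
    assume "\<not> ?thesis"
    then obtain u v where "u \<in> ball x r" "p = h u" "v \<in> ball x r" "q = h v" by blast
    then show False using inv[of u] inv[of v] \<open>(f ^^ i) p = (f ^^ i) q\<close> pq(1) by simp
  qed
  then obtain c where c: "c = p \<or> c = q" "c \<notin> h ` ball x r" by blast
  show ?thesis
    by (rule injective_image_omitted_continuum[OF open_ball convex_ball _ h inj c(2)])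
      (use r c(1) that in auto)
qed

text \<open>The branch omits a continuum through \<open>p\<close> or \<open>q\<close>, which bounds
  its derivative independently of \<open>n\<close>. But that derivative is the reciprocal of the
  derivative of \<open>f ^^ n\<close>, which is small at bounded times.\<close>

lemma wandering_domain_no_pullback:
  assumes W: "wandering_domain f W" "z \<in> W" and \<rho>: "\<rho> > 0"
  obtains N where "\<And>n h. n \<ge> N \<Longrightarrow> norm ((f ^^ n) z) \<le> B \<Longrightarrow> h holomorphic_on ball ((f ^^ n) z) \<rho> \<Longrightarrow>
    h ((f ^^ n) z) = z \<Longrightarrow> (\<And>y. y \<in> ball ((f ^^ n) z) \<rho> \<Longrightarrow> (f ^^ n) (h y) = y) \<Longrightarrow> False"
proof -
  obtain p q where pq: "p \<noteq> q" "f p = f q" using transcendental_not_injective[OF transcendental] by blast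
  define C where "C = max (norm (z - p)) (norm (z - q)) + 1"
  have C: "C > 0" by (simp add: C_def add_pos_nonneg less_max_iff_disj le_max_iff_disj add_nonneg_pos)
  have M: "distortion_const > 1" by (rule distortion_const_gt_1)
  define \<eta> where "\<eta> = \<rho> / (2 * distortion_const * C)"
  have \<eta>: "\<eta> > 0" using \<rho> C M by (simp add: \<eta>_def)
  obtain N where N: "\<And>n. n \<ge> N \<Longrightarrow> norm ((f ^^ n) z) \<le> B \<Longrightarrow> norm (deriv (f ^^ n) z) < \<eta>"
    using wandering_domain_deriv_small[OF W \<eta>] by blast
  show ?thesis
  \<comment> \<open>\<open>Suc N\<close> makes \<open>n\<close> positive, as the omission of
    \<open>p\<close> or \<open>q\<close> requires.\<close>
  proof (rule that[of "Suc N"])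
    fix n h
    let ?x = "(f ^^ n) z"
    assume n: "n \<ge> Suc N" and B: "norm ?x \<le> B" and h: "h holomorphic_on ball ?x \<rho>" "h ?x = z"
      and inv: "\<And>y. y \<in> ball ?x \<rho> \<Longrightarrow> (f ^^ n) (h y) = y"
    obtain c K where cK: "c = p \<or> c = q" "connected K" "\<not> bounded K" "c \<in> K" "h ` ball ?x \<rho> \<inter> K = {}"
      using pullback_omits_fibre_point[OF h(1) \<rho> inv _ pq] n by auto
    have "norm (deriv h ?x) \<le> 2 * distortion_const * norm (z - c) / \<rho>"
      using omitted_continuum_deriv_bound[OF h(1) \<rho> cK(2-5)] h(2) by simp
    also have "\<dots> \<le> 2 * distortion_const * C / \<rho>"
      using cK(1) M \<rho> by (intro divide_right_mono mult_left_mono) (auto simp: C_def)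
    finally have dh: "norm (deriv h ?x) \<le> 1 / \<eta>" by (simp add: \<eta>_def)
    have "((f ^^ n) has_field_derivative deriv (f ^^ n) (h ?x)) (at (h ?x))"
      using holo_funpow[of n UNIV] by (simp add: holomorphic_derivI)
    moreover have "(h has_field_derivative deriv h ?x) (at ?x)"
      using holomorphic_derivI[OF h(1)] \<rho> by simp
    ultimately have "((f ^^ n) \<circ> h has_field_derivative deriv (f ^^ n) (h ?x) * deriv h ?x) (at ?x)"
      by (rule DERIV_chain)
    then have "((\<lambda>y. y) has_field_derivative deriv (f ^^ n) (h ?x) * deriv h ?x) (at ?x)"
      by (rule has_field_derivative_transform_within[where d = \<rho>])
        (use \<rho> inv in \<open>auto simp: dist_commute\<close>)
    then have "deriv (f ^^ n) z * deriv h ?x = 1" using DERIV_ident DERIV_unique h(2) by metis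
    then have "1 = norm (deriv (f ^^ n) z) * norm (deriv h ?x)" by (metis norm_mult norm_one)
    also have "\<dots> \<le> norm (deriv (f ^^ n) z) * (1 / \<eta>)" by (intro mult_left_mono dh) simp
    also have "\<dots> < \<eta> * (1 / \<eta>)" using N[of n] n B \<eta> by (intro mult_strict_right_mono) auto
    finally show False using \<eta> by simp
  qed
qed

text \<open>The branch is lifted one step at a time. If it met \<open>S\<close> at \<open>s\<close>,
  then \<open>(f ^^ j) s\<close> would lie in the disc, contrary to the last assumption, which only
  weakens as \<open>j\<close> grows.\<close>

lemma extend_pullback:
  assumes "h holomorphic_on ball x \<rho>" "\<rho> > 0" "h x = (f ^^ i) z"
    and "\<And>y. y \<in> ball x \<rho> \<Longrightarrow> (f ^^ j) (h y) = y"
    and "\<And>m s. m \<ge> j \<Longrightarrow> s \<in> S \<Longrightarrow> (f ^^ m) s \<notin> ball x \<rho>"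
  shows "\<exists>k. k holomorphic_on ball x \<rho> \<and> k x = z \<and> (\<forall>y\<in>ball x \<rho>. (f ^^ (i + j)) (k y) = y)"
  using assms
proof (induction i arbitrary: j h)
  case 0
  then show ?case by auto
next
  case (Suc i)
  have avoid: "h ` ball x \<rho> \<inter> S = {}"
  proof -
    have "h y \<notin> S" if "y \<in> ball x \<rho>" for y
      using Suc.prems(4)[OF that] Suc.prems(5)[of j "h y"] that by auto
    then show ?thesis by blast
  qed
  obtain k where k: "k holomorphic_on ball x \<rho>" "k x = (f ^^ i) z" "\<And>y. y \<in> ball x \<rho> \<Longrightarrow> f (k y) = h y"
    by (rule holomorphic_lift[OF Suc.prems(1) convex_ball _ avoid, of x "(f ^^ i) z"])
      (use Suc.prems(2,3) in auto)
  have "\<exists>k. k holomorphic_on ball x \<rho> \<and> k x = z \<and> (\<forall>y\<in>ball x \<rho>. (f ^^ (i + Suc j)) (k y) = y)"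
  proof (rule Suc.IH[OF k(1) Suc.prems(2) k(2)])
    show "(f ^^ Suc j) (k y) = y" if "y \<in> ball x \<rho>" for y
      using k(3)[OF that] Suc.prems(4)[OF that] by (simp add: funpow_swap1)
    show "(f ^^ m) s \<notin> ball x \<rho>" if "m \<ge> Suc j" "s \<in> S" for m s
      using Suc.prems(5)[of m s] that by simp
  qed
  then show ?case by simp
qed

text \<open>Otherwise the identity on a disc, a pullback of length 0, extends along the whole
  orbit.\<close>

lemma wandering_orbit_near_postsingular:
  assumes W: "wandering_domain f W" "z \<in> W" and \<eta>: "\<eta> > 0"
  obtains N where "\<And>n. n \<ge> N \<Longrightarrow> norm ((f ^^ n) z) \<le> B \<Longrightarrow>
    \<exists>m. \<exists>s\<in>S. norm ((f ^^ n) z - (f ^^ m) s) < \<eta>"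
proof -
  obtain N where N: "\<And>n h. n \<ge> N \<Longrightarrow> norm ((f ^^ n) z) \<le> B \<Longrightarrow> h holomorphic_on ball ((f ^^ n) z) \<eta> \<Longrightarrow>
    h ((f ^^ n) z) = z \<Longrightarrow> (\<And>y. y \<in> ball ((f ^^ n) z) \<eta> \<Longrightarrow> (f ^^ n) (h y) = y) \<Longrightarrow> False"
    using wandering_domain_no_pullback[OF W \<eta>] by blast
  show ?thesis
  proof (rule that[of N], rule ccontr)
    fix n assume n: "n \<ge> N" "norm ((f ^^ n) z) \<le> B"
      and neg: "\<not> (\<exists>m. \<exists>s\<in>S. norm ((f ^^ n) z - (f ^^ m) s) < \<eta>)"
    have "\<exists>k. k holomorphic_on ball ((f ^^ n) z) \<eta> \<and> k ((f ^^ n) z) = z \<and>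
        (\<forall>y\<in>ball ((f ^^ n) z) \<eta>. (f ^^ (n + 0)) (k y) = y)"
      by (rule extend_pullback[of "\<lambda>y. y"]) (use \<eta> neg in \<open>auto simp: dist_norm intro: holomorphic_intros\<close>)
    then obtain k where "k holomorphic_on ball ((f ^^ n) z) \<eta>" "k ((f ^^ n) z) = z"
        "\<And>y. y \<in> ball ((f ^^ n) z) \<eta> \<Longrightarrow> (f ^^ n) (k y) = y"
      by (metis add_0_right)
    then show False by (rule N[OF n])
  qed
qed

lemma funpow_uniform_bound:
  obtains T' where "\<And>i u. i \<le> m \<Longrightarrow> norm u \<le> T \<Longrightarrow> norm ((f ^^ i) u) \<le> T'"
proof -
  have "\<exists>T'. \<forall>i\<le>m. \<forall>u. norm u \<le> T \<longrightarrow> norm ((f ^^ i) u) \<le> T'"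
  proof (induction m)
    case (Suc m)
    then obtain T1 where T1: "\<And>i u. i \<le> m \<Longrightarrow> norm u \<le> T \<Longrightarrow> norm ((f ^^ i) u) \<le> T1" by blast
    have "compact ((f ^^ Suc m) ` cball 0 T)" by (intro compact_continuous_image cont_funpow) auto
    then obtain T2 where "\<forall>u\<in>cball 0 T. norm ((f ^^ Suc m) u) \<le> T2"
      by (auto dest!: compact_imp_bounded simp: bounded_iff)
    then have T2: "norm ((f ^^ Suc m) u) \<le> T2" if "norm u \<le> T" for u
      using that by simp
    have "norm ((f ^^ i) u) \<le> max T1 T2" if "i \<le> Suc m" "norm u \<le> T" for i u
      using T1[of i u] T2[of u] that by (cases "i = Suc m") (auto simp: le_max_iff_disj simp del: funpow.simps)
    then show ?case by blast
  qed auto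
  then show ?thesis using that by blast
qed

text \<open>Otherwise, at late times, predecessors of bounded orbit points are bounded, and so are
  \<open>J\<close>-fold predecessors. Such a point is near some \<open>(f ^^ m) s\<close>, and
  \<open>J\<close> further iterates contradict the escape of \<open>S\<close>.\<close>

lemma wandering_orbit_entry:
  assumes W: "wandering_domain f W" "z \<in> W"
    and esc: "\<And>B. \<exists>m0. \<forall>m\<ge>m0. \<forall>s\<in>S. norm ((f ^^ m) s) > B"
  obtains B where "\<And>T N. \<exists>n\<ge>N. norm ((f ^^ Suc n) z) \<le> B \<and> norm ((f ^^ n) z) \<ge> T"
proof (rule ccontr)
  assume "\<not> thesis"
  then have neg: "\<exists>T N. \<forall>n\<ge>N. norm ((f ^^ Suc n) z) \<le> B \<longrightarrow> norm ((f ^^ n) z) < T" for B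
    using that not_le by metis
  have zF: "z \<in> fatou_set f"
    using W unfolding wandering_domain_def by (meson in_components_subset subsetD)
  obtain B where B: "\<And>N. \<exists>n\<ge>N. norm ((f ^^ n) z) \<le> B" using fatou_set_not_escaping zF by metis
  obtain J where J: "\<And>m s. m \<ge> J \<Longrightarrow> s \<in> S \<Longrightarrow> norm ((f ^^ m) s) > B + 1" using esc[of "B + 1"] by blast
  have backward: "\<exists>T N. \<forall>n\<ge>N. norm ((f ^^ (n + j)) z) \<le> B \<longrightarrow> norm ((f ^^ n) z) \<le> T" for j
  proof (induction j)
    case 0
    show ?case by auto
  next
    case (Suc j)
    then obtain T N where TN: "\<And>n. n \<ge> N \<Longrightarrow> norm ((f ^^ (n + j)) z) \<le> B \<Longrightarrow> norm ((f ^^ n) z) \<le> T"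
      by blast
    obtain T' N' where TN': "\<And>n. n \<ge> N' \<Longrightarrow> norm ((f ^^ Suc n) z) \<le> T \<Longrightarrow> norm ((f ^^ n) z) < T'"
      using neg[of T] by blast
    have "norm ((f ^^ n) z) \<le> T'" if "n \<ge> max N N'" "norm ((f ^^ (n + Suc j)) z) \<le> B" for n
      using TN[of "Suc n"] TN'[of n] that by fastforce
    then show ?case by blast
  qed
  obtain T N where T: "\<And>n. n \<ge> N \<Longrightarrow> norm ((f ^^ (n + J)) z) \<le> B \<Longrightarrow> norm ((f ^^ n) z) \<le> T"
    using backward[of J] by blast
  have "uniformly_continuous_on (cball 0 (T + 1)) (f ^^ J)"
    by (intro compact_uniformly_continuous cont_funpow) auto
  then obtain d where d: "d > 0" "\<And>u v. u \<in> cball 0 (T + 1) \<Longrightarrow> v \<in> cball 0 (T + 1) \<Longrightarrow> dist v u < d \<Longrightarrow>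
      dist ((f ^^ J) v) ((f ^^ J) u) < 1"
    unfolding uniformly_continuous_on_def by (metis zero_less_one)
  obtain N' where N': "\<And>n. n \<ge> N' \<Longrightarrow> norm ((f ^^ n) z) \<le> T \<Longrightarrow>
      \<exists>m. \<exists>s\<in>S. norm ((f ^^ n) z - (f ^^ m) s) < min d 1"
    using wandering_orbit_near_postsingular[OF W, of "min d 1" T] d(1) by auto
  obtain n where n: "n \<ge> N + N' + J" "norm ((f ^^ n) z) \<le> B" using B by blast
  define k where "k = n - J"
  have k: "n = k + J" "k \<ge> N" "k \<ge> N'" using n(1) by (simp_all add: k_def)
  have Tk: "norm ((f ^^ k) z) \<le> T" using T[of k] k n(2) by simp
  obtain m s where ms: "s \<in> S" "norm ((f ^^ k) z - (f ^^ m) s) < min d 1" using N'[OF k(3) Tk] by blast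
  have "norm ((f ^^ m) s) \<le> T + 1"
    using ms(2) Tk norm_triangle_sub[of "(f ^^ m) s" "(f ^^ k) z"] by (simp add: norm_minus_commute)
  then have "dist ((f ^^ J) ((f ^^ k) z)) ((f ^^ J) ((f ^^ m) s)) < 1"
    using ms(2) Tk by (intro d(2)) (auto simp: dist_norm)
  moreover have "(f ^^ J) ((f ^^ k) z) = (f ^^ n) z" unfolding k(1) by (simp add: funpow_add add.commute)
  moreover have "(f ^^ J) ((f ^^ m) s) = (f ^^ (J + m)) s" by (simp add: funpow_add)
  ultimately have "norm ((f ^^ (J + m)) s) < B + 1"
    using n(2) norm_triangle_sub[of "(f ^^ (J + m)) s" "(f ^^ n) z"]
    by (simp add: dist_norm norm_minus_commute)
  moreover have "norm ((f ^^ (J + m)) s) > B + 1" using J ms(1) by simp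
  ultimately show False by simp
qed

text \<open>
  Otherwise small discs about the points at which the orbit re-enters a bounded region can be
  pulled back along the whole orbit: the first steps only meet points far from \<open>S\<close>, and later
  steps are unobstructed because \<open>(f ^^ m) ` S\<close> leaves the region.
\<close>

lemma wandering_orbit_returns_near_S:
  assumes W: "wandering_domain f W" "z \<in> W"
    and esc: "\<And>B. \<exists>m0. \<forall>m\<ge>m0. \<forall>s\<in>S. norm ((f ^^ m) s) > B"
    and \<delta>: "\<delta> > 0"
  shows "\<exists>n\<ge>N. norm ((f ^^ n) z) \<ge> R \<and> (\<exists>s\<in>S. norm ((f ^^ Suc n) z - s) \<le> \<delta>)"
proof (rule ccontr)
  assume neg: "\<not> ?thesis"
  obtain B where B: "\<And>T N. \<exists>n\<ge>N. norm ((f ^^ Suc n) z) \<le> B \<and> norm ((f ^^ n) z) \<ge> T"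
    using wandering_orbit_entry[OF W esc] by blast
  obtain m0 where m0: "\<And>m s. m \<ge> m0 \<Longrightarrow> s \<in> S \<Longrightarrow> norm ((f ^^ m) s) > B + \<delta>" using esc[of "B + \<delta>"] by blast
  obtain p q where pq: "p \<noteq> q" "f p = f q" using transcendental_not_injective[OF transcendental] by blast
  obtain b0 where b0: "b0 > 0" "S \<subseteq> ball 0 b0" using bounded_subset_ballD[OF bounded_S, of 0] by blast
  define C where "C = max (norm p) (norm q)"
  \<comment> \<open>If the branch exceeds \<open>T\<close> in modulus at the centre and omits a
    continuum through a point of modulus at most \<open>C\<close>, distortion keeps it outside
    \<open>ball 0 b0\<close> on the half disc.\<close>
  define T where "T = distortion_const * (b0 + C) + C"
  obtain T' where T': "\<And>i u. i \<le> m0 \<Longrightarrow> norm u \<le> T \<Longrightarrow> norm ((f ^^ i) u) \<le> T'"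
    using funpow_uniform_bound by blast
  \<comment> \<open>Each of the first \<open>m0\<close> lifts halves the radius, since distortion is
    controlled only on the half disc.\<close>
  have \<rho>: "\<delta> / 2 ^ m0 > 0" using \<delta> by simp
  obtain N' where N': "\<And>n h. n \<ge> N' \<Longrightarrow> norm ((f ^^ n) z) \<le> B \<Longrightarrow>
    h holomorphic_on ball ((f ^^ n) z) (\<delta> / 2 ^ m0) \<Longrightarrow> h ((f ^^ n) z) = z \<Longrightarrow>
    (\<And>y. y \<in> ball ((f ^^ n) z) (\<delta> / 2 ^ m0) \<Longrightarrow> (f ^^ n) (h y) = y) \<Longrightarrow> False"
    using wandering_domain_no_pullback[OF W \<rho>] by blast
  obtain n where n: "n \<ge> N + N' + m0" "norm ((f ^^ Suc n) z) \<le> B" "norm ((f ^^ n) z) \<ge> max R (T' + 1)"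
    using B by blast
  define x where "x = (f ^^ Suc n) z"
  have farS: "norm (x - s) > \<delta>" if "s \<in> S" for s
  proof -
    have "n \<ge> N" "norm ((f ^^ n) z) \<ge> R" using n by auto
    then show ?thesis using neg that unfolding x_def by (meson not_le)
  qed
  \<comment> \<open>A point of modulus at most \<open>T\<close> so few steps earlier would force
    \<open>norm ((f ^^ n) z) \<le> T'\<close>.\<close>
  have large: "norm ((f ^^ (Suc n - i)) z) > T" if i: "1 \<le> i" "i \<le> m0" for i
  proof (rule ccontr)
    assume "\<not> ?thesis"
    then have "norm ((f ^^ (i - 1)) ((f ^^ (Suc n - i)) z)) \<le> T'" using i by (intro T') auto
    moreover have "(f ^^ (i - 1)) ((f ^^ (Suc n - i)) z) = (f ^^ n) z"
    proof -
      have "(i - 1) + (Suc n - i) = n" using i n(1) by simp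
      then show ?thesis by (metis comp_apply funpow_add)
    qed
    ultimately show False using n(3) by simp
  qed
  have "\<exists>h. h holomorphic_on ball x (\<delta> / 2 ^ i) \<and> h x = (f ^^ (Suc n - i)) z \<and>
      (\<forall>y\<in>ball x (\<delta> / 2 ^ i). (f ^^ i) (h y) = y)" if "i \<le> m0" for i
    using that
  proof (induction i)
    case 0
    show ?case by (intro exI[of _ "\<lambda>y. y"]) (auto simp: x_def intro: holomorphic_intros)
  next
    case (Suc i)
    then obtain h where h: "h holomorphic_on ball x (\<delta> / 2 ^ i)" "h x = (f ^^ (Suc n - i)) z"
      and inv: "\<And>y. y \<in> ball x (\<delta> / 2 ^ i) \<Longrightarrow> (f ^^ i) (h y) = y"
      by auto
    have r: "\<delta> / 2 ^ i > 0" "\<delta> / 2 ^ Suc i = \<delta> / 2 ^ i / 2" using \<delta> by simp_all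
    have sub: "ball x (\<delta> / 2 ^ Suc i) \<subseteq> ball x (\<delta> / 2 ^ i)" using r by (intro subset_ball) simp
    have avoid: "h y \<notin> S" if y: "y \<in> ball x (\<delta> / 2 ^ Suc i)" for y
    proof (cases "i = 0")
      case True
      then have "h y = y" "norm (x - y) < \<delta>" using inv[of y] y \<delta> by (auto simp: dist_norm)
      then show ?thesis using farS[of y] by auto
    next
      case False
      obtain c K where cK: "c = p \<or> c = q" "connected K" "\<not> bounded K" "c \<in> K" "h ` ball x (\<delta> / 2 ^ i) \<inter> K = {}"
        using pullback_omits_fibre_point[OF h(1) r(1) inv _ pq] False by blast
      have cC: "norm c \<le> C" using cK(1) by (auto simp: C_def)
      have "y \<in> cball x (\<delta> / 2 ^ i / 2)" using y r(2) by auto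
      then have "norm (h x - c) \<le> distortion_const * norm (h y - c)"
        by (rule omitted_continuum_distortion(2)[OF h(1) r(1) cK(2-5)])
      moreover have "norm (h x) > T" using large[of i] False Suc.prems h(2) by simp
      then have "norm (h x - c) > distortion_const * (b0 + C)"
        using norm_triangle_ineq2[of "h x" c] cC by (simp add: T_def)
      ultimately have "distortion_const * (b0 + C) < distortion_const * norm (h y - c)" by linarith
      then have "b0 + C < norm (h y - c)"
        using distortion_const_gt_1 by (subst (asm) mult_less_cancel_left_pos) auto
      then have "norm (h y) > b0" using norm_triangle_ineq4[of "h y" c] cC by simp
      then show ?thesis using b0(2) by auto
    qed
    obtain k where k: "k holomorphic_on ball x (\<delta> / 2 ^ Suc i)" "k x = (f ^^ (Suc n - Suc i)) z"
      "\<And>y. y \<in> ball x (\<delta> / 2 ^ Suc i) \<Longrightarrow> f (k y) = h y"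
    proof (rule holomorphic_lift[OF holomorphic_on_subset[OF h(1) sub] convex_ball, of x "(f ^^ (Suc n - Suc i)) z"])
      show "x \<in> ball x (\<delta> / 2 ^ Suc i)" using \<delta> by simp
      show "h ` ball x (\<delta> / 2 ^ Suc i) \<inter> S = {}" using avoid by blast
      have "Suc n - i = Suc (Suc n - Suc i)" using Suc.prems n(1) by simp
      then show "f ((f ^^ (Suc n - Suc i)) z) = h x" using h(2) by simp
    qed (use that in blast)
    have "(f ^^ Suc i) (k y) = y" if "y \<in> ball x (\<delta> / 2 ^ Suc i)" for y
      using k(3)[OF that] inv[of y] sub that by (simp add: funpow_swap1 subset_iff)
    then show ?case using k by blast
  qed
  from this[OF order_refl] obtain h where h: "h holomorphic_on ball x (\<delta> / 2 ^ m0)"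
    "h x = (f ^^ (Suc n - m0)) z" "\<And>y. y \<in> ball x (\<delta> / 2 ^ m0) \<Longrightarrow> (f ^^ m0) (h y) = y"
    by blast
  \<comment> \<open>From step \<open>m0\<close> on, the escape of \<open>S\<close> removes every
    obstruction.\<close>
  have "\<exists>k. k holomorphic_on ball x (\<delta> / 2 ^ m0) \<and> k x = z \<and>
      (\<forall>y\<in>ball x (\<delta> / 2 ^ m0). (f ^^ ((Suc n - m0) + m0)) (k y) = y)"
  proof (rule extend_pullback[OF h(1) \<rho> h(2,3)])
    fix m s assume ms: "m \<ge> m0" "s \<in> S"
    have "\<delta> / 2 ^ m0 \<le> \<delta>" using \<delta> by (simp add: divide_le_eq mult_le_cancel_left1)
    then show "(f ^^ m) s \<notin> ball x (\<delta> / 2 ^ m0)"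
      using m0[OF ms] n(2) norm_triangle_sub[of "(f ^^ m) s" x]
      by (auto simp: dist_norm norm_minus_commute x_def simp del: funpow.simps)
  qed
  moreover have "(Suc n - m0) + m0 = Suc n" using n(1) by simp
  ultimately show False using N'[of "Suc n"] n(1,2) unfolding x_def by (metis add_leE le_SucI)
qed

end

subsection \<open>Expansion in the complement of an invariant set\<close>

lemma norm_cis_diff_le: "norm (cis a - cis b) \<le> \<bar>a - b\<bar>"
proof -
  have *: "(norm (cis t - 1))\<^sup>2 \<le> \<bar>t\<bar>\<^sup>2" for t
  proof -
    have "(norm (cis t - 1))\<^sup>2 = (cos t - 1)\<^sup>2 + (sin t)\<^sup>2" by (simp add: cmod_power2)
    also have "\<dots> = 2 - 2 * cos t"
      using sin_cos_squared_add[of t] by (simp add: power2_eq_square algebra_simps)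
    also have "\<dots> = 4 * (sin (t/2))\<^sup>2" using cos_double_sin[of "t/2"] by simp
    also have "\<dots> = 4 * \<bar>sin (t/2)\<bar>\<^sup>2" by simp
    also have "\<dots> \<le> 4 * \<bar>t/2\<bar>\<^sup>2"
      by (intro mult_left_mono power_mono abs_sin_x_le_abs_x) auto
    finally show ?thesis by (simp add: power2_eq_square)
  qed
  have "cis a - cis b = cis b * (cis (a - b) - 1)" by (simp add: algebra_simps cis_mult)
  then have "norm (cis a - cis b) = norm (cis (a - b) - 1)" by (simp add: norm_mult)
  also have "\<dots> \<le> \<bar>a - b\<bar>" by (rule power2_le_imp_le[OF *]) simp
  finally show ?thesis .
qed

text \<open>Monotonicity of \<open>2 * sqrt s / (1 + s)\<close> on the unit interval, from
  \<open>0 \<le> (v - u) * (1 - u * v)\<close> for the square roots.\<close>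

lemma two_sqrt_over_mono:
  fixes s t :: real
  assumes "0 \<le> s" "s \<le> t" "t < 1" "x * (1 + s) \<le> 2 * sqrt s"
  shows "x \<le> 2 * sqrt t / (1 + t)"
proof -
  define u v where "u = sqrt s" and "v = sqrt t"
  have uv: "0 \<le> u" "u \<le> v" "v < 1" "s = u\<^sup>2" "t = v\<^sup>2"
    using assms by (auto simp: u_def v_def real_sqrt_lt_1_iff)
  have "0 \<le> (v - u) * (1 - u * v)"
    using uv mult_mono[of u 1 v 1] by (intro mult_nonneg_nonneg) auto
  then have "u * (1 + t) \<le> v * (1 + s)" unfolding uv by (simp add: power2_eq_square algebra_simps)
  moreover have "x * (1 + s) * (1 + t) \<le> 2 * u * (1 + t)"
    using assms by (intro mult_right_mono) (auto simp: u_def)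
  ultimately have "(x * (1 + t)) * (1 + s) \<le> (2 * v) * (1 + s)" by (simp add: algebra_simps)
  then have "x * (1 + t) \<le> 2 * v" using assms(1) by (simp add: mult_le_cancel_right)
  then show ?thesis using assms by (simp add: pos_le_divide_eq v_def)
qed

locale invariant_unbounded_set = entire_covering +
  fixes A :: "complex set"
  assumes closed_A: "closed A" and nonempty_A: "A \<noteq> {}"
    and unbounded_A: "\<forall>C\<in>components A. \<not> bounded C"
    and S_subset_A: "S \<subseteq> A" and image_A: "f ` A \<subseteq> A"
begin

abbreviation comp_at :: "complex \<Rightarrow> complex set" where
  "comp_at x \<equiv> connected_component_set (- A) x"

lemma comp_at_avoids: "y \<in> comp_at x \<Longrightarrow> y \<notin> A"
  using connected_component_subset[of "- A" x] by blast

lemma open_comp_at: "open (comp_at x)"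
  using closed_A by (intro open_connected_component) (simp add: open_Compl)

lemma connected_subset_comp_at:
  assumes "connected X" "X \<inter> A = {}" "y \<in> X" "y \<in> comp_at x"
  shows "X \<subseteq> comp_at x"
proof -
  have "comp_at y = comp_at x" using assms(4) by (simp add: connected_component_eq)
  moreover have "X \<subseteq> comp_at y" by (rule connected_component_maximal) (use assms in auto)
  ultimately show ?thesis by simp
qed

lemma self_in_comp_at: "x \<notin> A \<Longrightarrow> x \<in> comp_at x"
  by (simp add: connected_component_refl)

text \<open>
  The hyperbolic derivative of \<open>f ^^ n\<close> on the complement of \<open>A\<close> increases with \<open>n\<close> but is bounded
  by the Schwarz lemma, so the inverse branches of \<open>f\<close> along the orbit, read in the Riemann
  maps of the complementary components, are asymptotically rotations.
\<close>

lemma orbit_asymptotically_isometric: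
  assumes r: "r > 0" and avoid: "\<And>w n. w \<in> ball z r \<Longrightarrow> (f ^^ n) w \<notin> A" and t: "0 \<le> t" "t < 1"
  obtains N where "\<And>n. n \<ge> N \<Longrightarrow> \<exists>\<phi>. \<phi> holomorphic_on comp_at ((f ^^ n) z) \<and>
    \<phi> ` comp_at ((f ^^ n) z) \<subseteq> ball 0 1 \<and> \<phi> ((f ^^ n) z) = 0 \<and>
    (\<forall>y\<in>comp_at ((f ^^ n) z). norm (\<phi> y) \<le> t \<longrightarrow> f y \<notin> A)"
proof -
  define x where "x n = (f ^^ n) z" for n
  define U where "U n = comp_at (x n)" for n
  have zb: "z \<in> ball z r" using r by simp
  have xA: "x n \<notin> A" for n unfolding x_def by (rule avoid[OF zb])
  have xU: "x n \<in> U n" for n unfolding U_def by (rule self_in_comp_at[OF xA])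
  have opU: "open (U n)" for n unfolding U_def by (rule open_comp_at)
  have fx: "f (x n) = x (Suc n)" for n by (simp add: x_def)
  have "\<exists>\<psi> \<phi>. \<psi> holomorphic_on ball 0 1 \<and> \<psi> ` ball 0 1 \<subseteq> U n \<and> \<psi> 0 = x n \<and> \<phi> (x n) = 0 \<and>
      \<phi> holomorphic_on U n \<and> \<phi> ` U n \<subseteq> ball 0 1 \<and> (\<forall>\<zeta>\<in>ball 0 1. \<phi> (\<psi> \<zeta>) = \<zeta>) \<and> (\<forall>y\<in>U n. \<psi> (\<phi> y) = y)" for n
    unfolding U_def
    by (rule Riemann_map_component_of_Compl[OF closed_A unbounded_A xA[of n] nonempty_A]) blast
  then obtain \<psi> \<phi> where
        \<psi>: "\<And>n. \<psi> n holomorphic_on ball 0 1" "\<And>n. \<psi> n ` ball 0 1 \<subseteq> U n" "\<And>n. \<psi> n 0 = x n"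
    and \<phi>: "\<And>n. \<phi> n (x n) = 0" "\<And>n. \<phi> n holomorphic_on U n" "\<And>n. \<phi> n ` U n \<subseteq> ball 0 1"
    and \<phi>\<psi>: "\<And>n \<zeta>. \<zeta> \<in> ball 0 1 \<Longrightarrow> \<phi> n (\<psi> n \<zeta>) = \<zeta>"
    and \<psi>\<phi>: "\<And>n y. y \<in> U n \<Longrightarrow> \<psi> n (\<phi> n y) = y"
    by metis
  \<comment> \<open>\<open>\<sigma>\<close> is the inverse branch of \<open>f\<close> along the
    orbit, read in the next Riemann map. Forward invariance of \<open>A\<close> keeps its image off
    \<open>A\<close>, hence in \<open>U n\<close>.\<close>
  have "\<exists>\<sigma>. \<sigma> holomorphic_on ball 0 1 \<and> \<sigma> 0 = x n \<and> (\<forall>\<zeta>\<in>ball 0 1. f (\<sigma> \<zeta>) = \<psi> (Suc n) \<zeta>)" for n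
  proof -
    have "\<psi> (Suc n) ` ball 0 1 \<inter> S = {}"
      using \<psi>(2)[of "Suc n"] S_subset_A comp_at_avoids unfolding U_def by blast
    moreover have "f (x n) = \<psi> (Suc n) 0" using \<psi>(3)[of "Suc n"] fx by simp
    ultimately obtain k where "k holomorphic_on ball 0 1" "k 0 = x n"
        "\<And>\<zeta>. \<zeta> \<in> ball 0 1 \<Longrightarrow> f (k \<zeta>) = \<psi> (Suc n) \<zeta>"
      using holomorphic_lift[OF \<psi>(1)[of "Suc n"] convex_ball]
      by (metis centre_in_ball zero_less_one)
    then show ?thesis by blast
  qed
  then obtain \<sigma> where \<sigma>: "\<And>n. \<sigma> n holomorphic_on ball 0 1" "\<And>n. \<sigma> n 0 = x n"
    "\<And>n \<zeta>. \<zeta> \<in> ball 0 1 \<Longrightarrow> f (\<sigma> n \<zeta>) = \<psi> (Suc n) \<zeta>"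
    by metis
  have \<psi>A: "\<psi> n \<zeta> \<notin> A" if "\<zeta> \<in> ball 0 1" for n \<zeta>
    using \<psi>(2)[of n] that comp_at_avoids unfolding U_def by blast
  have \<sigma>U: "\<sigma> n ` ball 0 1 \<subseteq> U n" for n
    unfolding U_def
  proof (rule connected_subset_comp_at)
    show "connected (\<sigma> n ` ball 0 1)"
      by (intro connected_continuous_image holomorphic_on_imp_continuous_on \<sigma>(1)) auto
    show "\<sigma> n ` ball 0 1 \<inter> A = {}" using \<psi>A \<sigma>(3) image_A by fastforce
    show "x n \<in> \<sigma> n ` ball 0 1" using \<sigma>(2)[of n] by (metis centre_in_ball image_eqI zero_less_one)
    show "x n \<in> comp_at (x n)" using xU by (simp add: U_def)
  qed
  define b where "b n = \<phi> n \<circ> \<sigma> n" for n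
  have b: "b n holomorphic_on ball 0 1" "b n 0 = 0" "\<And>\<zeta>. norm \<zeta> < 1 \<Longrightarrow> norm (b n \<zeta>) < 1" for n
  proof -
    show "b n holomorphic_on ball 0 1"
      unfolding b_def by (rule holomorphic_on_compose_gen[OF \<sigma>(1) \<phi>(2) \<sigma>U])
    show "b n 0 = 0" using \<sigma>(2) \<phi>(1) by (simp add: b_def)
    show "norm (b n \<zeta>) < 1" if "norm \<zeta> < 1" for \<zeta>
      using \<sigma>U[of n] \<phi>(3)[of n] that by (force simp: b_def)
  qed
  \<comment> \<open>Up to constants, \<open>D n\<close> is the derivative of \<open>f ^^ n\<close>
    at \<open>z\<close>, measured in the hyperbolic metric of \<open>U n\<close> at
    \<open>x n\<close>.\<close>
  define D where "D n = norm (deriv (\<phi> n) (x n)) * norm (deriv (f ^^ n) z)" for n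
  have d\<phi>: "(\<phi> n has_field_derivative deriv (\<phi> n) (x n)) (at (x n))" for n
    by (rule holomorphic_derivI[OF \<phi>(2) opU xU])
  have d\<phi>\<psi>: "deriv (\<phi> n) (x n) * deriv (\<psi> n) 0 = 1" for n
  proof -
    have "(\<phi> n \<circ> \<psi> n has_field_derivative deriv (\<phi> n) (x n) * deriv (\<psi> n) 0) (at 0)"
      using d\<phi>[of n] \<psi>(3)[of n] holomorphic_derivI[OF \<psi>(1), of 0 n] by (intro DERIV_chain) auto
    then have "((\<lambda>\<zeta>. \<zeta>) has_field_derivative deriv (\<phi> n) (x n) * deriv (\<psi> n) 0) (at 0)"
      by (rule has_field_derivative_transform_within[where d = 1]) (use \<phi>\<psi> in auto)
    then show ?thesis using DERIV_ident DERIV_unique by blast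
  qed
  have df\<sigma>: "deriv f (x n) * deriv (\<sigma> n) 0 = deriv (\<psi> (Suc n)) 0" for n
  proof -
    have "(f \<circ> \<sigma> n has_field_derivative deriv f (x n) * deriv (\<sigma> n) 0) (at 0)"
      using has_deriv[of "x n"] \<sigma>(2)[of n] holomorphic_derivI[OF \<sigma>(1), of 0 n] by (intro DERIV_chain) auto
    then have "(\<psi> (Suc n) has_field_derivative deriv f (x n) * deriv (\<sigma> n) 0) (at 0)"
      by (rule has_field_derivative_transform_within[where d = 1]) (use \<sigma>(3) in auto)
    then show ?thesis by (simp add: DERIV_imp_deriv)
  qed
  have db: "deriv (b n) 0 = deriv (\<phi> n) (x n) * deriv (\<sigma> n) 0" for n
  proof -
    have "(b n has_field_derivative deriv (\<phi> n) (x n) * deriv (\<sigma> n) 0) (at 0)"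
      unfolding b_def using d\<phi>[of n] \<sigma>(2)[of n] holomorphic_derivI[OF \<sigma>(1), of 0 n]
      by (intro DERIV_chain) auto
    then show ?thesis by (rule DERIV_imp_deriv)
  qed
  have Dstep: "D n = D (Suc n) * norm (deriv (b n) 0)" for n
  proof -
    have "deriv (\<phi> (Suc n)) (x (Suc n)) * deriv (f ^^ Suc n) z * deriv (b n) 0 =
        (deriv (\<phi> (Suc n)) (x (Suc n)) * (deriv f (x n) * deriv (\<sigma> n) 0)) * deriv (\<phi> n) (x n) * deriv (f ^^ n) z"
      by (simp add: deriv_funpow_Suc db x_def ac_simps del: funpow.simps)
    also have "\<dots> = deriv (\<phi> n) (x n) * deriv (f ^^ n) z" by (simp add: df\<sigma> d\<phi>\<psi>)
    finally show ?thesis unfolding D_def by (metis norm_mult)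
  qed
  have b1: "norm (deriv (b n) 0) \<le> 1" for n by (rule Schwarz_Lemma(2)[OF b, of 0]) auto
  have Dbound: "D n \<le> 1 / (r/2)" for n
  proof -
    have im: "(f ^^ n) ` ball z r \<subseteq> U n"
      unfolding U_def
    proof (rule connected_subset_comp_at)
      show "connected ((f ^^ n) ` ball z r)" by (intro connected_continuous_image cont_funpow) auto
      show "(f ^^ n) ` ball z r \<inter> A = {}" using avoid by blast
      show "x n \<in> (f ^^ n) ` ball z r" using zb by (simp add: x_def)
      show "x n \<in> comp_at (x n)" using xU by (simp add: U_def)
    qed
    have hol: "(\<phi> n \<circ> (f ^^ n)) holomorphic_on ball z r"
      by (rule holomorphic_on_compose_gen[OF holo_funpow \<phi>(2) im])
    have "norm ((deriv ^^ 1) (\<phi> n \<circ> (f ^^ n)) z) \<le> fact 1 * 1 / (r/2) ^ 1"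
    proof (rule Cauchy_inequality)
      show "(\<phi> n \<circ> (f ^^ n)) holomorphic_on ball z (r/2)"
        using r by (intro holomorphic_on_subset[OF hol]) auto
      show "continuous_on (cball z (r/2)) (\<phi> n \<circ> (f ^^ n))"
        using r by (intro holomorphic_on_imp_continuous_on holomorphic_on_subset[OF hol]) auto
      show "norm ((\<phi> n \<circ> (f ^^ n)) w) \<le> 1" if "norm (z - w) = r/2" for w
      proof -
        have "w \<in> ball z r" using that r by (simp add: dist_norm)
        then have "\<phi> n ((f ^^ n) w) \<in> ball 0 1" using im \<phi>(3)[of n] by blast
        then show ?thesis by simp
      qed
    qed (use r in auto)
    moreover have "((\<phi> n \<circ> (f ^^ n)) has_field_derivative deriv (\<phi> n) (x n) * deriv (f ^^ n) z) (at z)"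
      using d\<phi>[of n] holomorphic_derivI[OF holo_funpow[of n UNIV], of z] unfolding x_def
      by (intro DERIV_chain) auto
    ultimately show ?thesis by (simp add: D_def DERIV_imp_deriv norm_mult)
  qed
  have Dmono: "D n \<le> D (Suc n)" for n
    using Dstep[of n] b1[of n] mult_left_mono[of "norm (deriv (b n) 0)" 1 "D (Suc n)"] by (simp add: D_def)
  have "deriv (\<lambda>y. y) z = 1" by simp
  then have D0: "D 0 > 0" using d\<phi>\<psi>[of 0] by (auto simp: D_def id_def)
  obtain L where L: "D \<longlonglongrightarrow> L" "\<And>n. D n \<le> L"
    using incseq_convergent[of D "1 / (r/2)"] Dmono Dbound by (auto intro: incseq_SucI)
  have L0: "L > 0" using L(2)[of 0] D0 by linarith
  have Dpos: "D n > 0" for n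
    using lift_Suc_mono_le[of D 0 n] Dmono D0 by (simp add: less_le_trans)
  \<comment> \<open>The limit of \<open>D\<close> is positive, so consecutive ratios, which are the
    moduli of the derivatives of \<open>b n\<close> at 0, tend to 1.\<close>
  have "(\<lambda>n. D n / D (Suc n)) \<longlonglongrightarrow> L / L"
    using L0 by (intro tendsto_divide L(1) LIMSEQ_Suc) auto
  moreover have "D n / D (Suc n) = norm (deriv (b n) 0)" for n
    using Dstep[of n] Dpos[of "Suc n"] by (simp add: field_simps)
  ultimately have lim: "(\<lambda>n. norm (deriv (b n) 0)) \<longlonglongrightarrow> 1" using L0 by simp
  have "2 * sqrt t / (1 + t) < 1"
  proof -
    have "sqrt t < 1" using t by simp
    then have "0 < (1 - sqrt t)\<^sup>2" by simp
    also have "(1 - sqrt t)\<^sup>2 = 1 + t - 2 * sqrt t" using t by (simp add: power2_diff)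
    finally show ?thesis using t by simp
  qed
  then have "eventually (\<lambda>n. 2 * sqrt t / (1 + t) < norm (deriv (b n) 0)) sequentially"
    by (rule order_tendstoD(1)[OF lim])
  then obtain N where N: "\<And>n. n \<ge> N \<Longrightarrow> 2 * sqrt t / (1 + t) < norm (deriv (b n) 0)"
    unfolding eventually_sequentially by blast
  have "f y \<notin> A" if n: "n \<ge> N" and y: "y \<in> U n" "norm (\<phi> n y) \<le> t" for n y
  proof -
    \<comment> \<open>An omitted value of modulus at most \<open>t\<close> would keep the derivative
      of \<open>b n\<close> below the threshold in \<open>N\<close>.\<close>
    have "\<phi> n y \<in> b n ` ball 0 1"
    proof (rule ccontr)
      assume "\<phi> n y \<notin> b n ` ball 0 1"
      then have "norm (deriv (b n) 0) * (1 + norm (\<phi> n y)) \<le> 2 * sqrt (norm (\<phi> n y))"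
        by (intro disc_map_omitting_value_deriv_bound b) (use y t in auto)
      then have "norm (deriv (b n) 0) \<le> 2 * sqrt t / (1 + t)"
        by (intro two_sqrt_over_mono[of "norm (\<phi> n y)"]) (use y t in auto)
      then show False using N[OF n] by simp
    qed
    then obtain \<zeta> where \<zeta>: "\<zeta> \<in> ball 0 1" "\<phi> n y = \<phi> n (\<sigma> n \<zeta>)" by (auto simp: b_def)
    have "\<sigma> n \<zeta> \<in> U n" using \<sigma>U[of n] \<zeta>(1) by blast
    then have "y = \<sigma> n \<zeta>" using \<psi>\<phi> y(1) \<zeta>(2) by metis
    then show ?thesis using \<sigma>(3)[OF \<zeta>(1)] \<psi>A[OF \<zeta>(1)] by simp
  qed
  then show ?thesis
    using \<phi> unfolding U_def x_def by (intro that[of N]) blast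
qed

text \<open>
  If \<open>f\<close> is close to \<open>s\<close> at a point of the circle, the hypothesis \<open>sep\<close> makes a whole disc about it
  avoid \<open>A\<close>; the component of \<open>A\<close> through \<open>s\<close> is omitted by \<open>f\<close> on half of that disc, so the
  distortion estimate moves the closeness to the next point at the cost of one factor
  \<open>distortion_const\<close>. The Schwarz-Pick inequality keeps the chain of discs within a fixed compact
  part of the Riemann disc.
\<close>

lemma small_on_circle:
  assumes x: "x \<notin> A" "x \<noteq> 0"
    and \<phi>: "\<phi> holomorphic_on comp_at x" "\<phi> ` comp_at x \<subseteq> ball 0 1" "\<phi> x = 0"
    and good: "\<And>y. y \<in> comp_at x \<Longrightarrow> (3/16) ^ N \<le> 1 - (norm (\<phi> y))\<^sup>2 \<Longrightarrow> f y \<notin> A"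
    and s: "s \<in> S" "norm (f x - s) \<le> \<epsilon> / distortion_const ^ N"
    and \<kappa>: "\<kappa> > 0" "pi \<le> real N * (\<kappa> / 4)"
    and sep: "\<And>y. norm y = norm x \<Longrightarrow> norm (f y - s) \<le> \<epsilon> \<Longrightarrow> ball y (\<kappa> * norm x) \<inter> A = {}"
    and y: "norm y = norm x"
  shows "norm (f y - s) \<le> \<epsilon>"
proof -
  have M: "distortion_const > 1" by (rule distortion_const_gt_1)
  have "0 \<le> \<epsilon> / distortion_const ^ N" using s(2) norm_ge_zero order_trans by blast
  moreover have "distortion_const ^ N > 0" using M by simp
  ultimately have \<epsilon>: "\<epsilon> \<ge> 0" by (simp add: zero_le_divide_iff)
  have \<epsilon>_le: "\<epsilon> / distortion_const ^ k \<le> \<epsilon>" for k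
  proof -
    have "1 \<le> distortion_const ^ k" using M by (intro one_le_power) simp
    then show ?thesis using \<epsilon> mult_left_mono[of 1 "distortion_const ^ k" \<epsilon>] by (simp add: divide_le_eq)
  qed
  have sA: "s \<in> A" using s(1) S_subset_A by blast
  define K where "K = connected_component_set A s"
  have "K \<in> components A" using sA by (auto simp: K_def components_def)
  then have K: "connected K" "\<not> bounded K" "s \<in> K" "K \<subseteq> A"
    using unbounded_A sA connected_component_subset[of A s]
    by (auto simp: K_def connected_component_refl)
  define \<rho> where "\<rho> = \<kappa> * norm x"
  have \<rho>: "\<rho> > 0" using \<kappa> x by (simp add: \<rho>_def)
  have claim: "x * cis \<theta> \<in> comp_at x \<and> (3/16) ^ j \<le> 1 - (norm (\<phi> (x * cis \<theta>)))\<^sup>2 \<and>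
      norm (f (x * cis \<theta>) - s) \<le> \<epsilon> / distortion_const ^ (N - j)"
    if "j \<le> N" "\<bar>\<theta>\<bar> \<le> real j * (\<kappa> / 4)" for j \<theta>
    using that
  proof (induction j arbitrary: \<theta>)
    case 0
    then show ?case using self_in_comp_at[OF x(1)] \<phi>(3) s(2) by simp
  next
    case (Suc j)
    \<comment> \<open>Proportional shrinking gives an angle in the range for \<open>j\<close> that
      differs from \<open>\<theta>\<close> by at most \<open>\<kappa> / 4\<close>.\<close>
    define \<theta>0 where "\<theta>0 = \<theta> * (real j / real (Suc j))"
    have "\<bar>\<theta>0\<bar> = \<bar>\<theta>\<bar> * (real j / real (Suc j))" by (simp add: \<theta>0_def abs_mult)
    also have "\<dots> \<le> (real (Suc j) * (\<kappa> / 4)) * (real j / real (Suc j))"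
      using Suc.prems(2) by (intro mult_right_mono) auto
    also have "\<dots> = real j * (\<kappa> / 4)" by (simp add: field_simps del: of_nat_Suc)
    finally have \<theta>0: "\<bar>\<theta>0\<bar> \<le> real j * (\<kappa> / 4)" .
    have "\<theta> - \<theta>0 = \<theta> / real (Suc j)" by (simp add: \<theta>0_def field_simps)
    then have "\<bar>\<theta> - \<theta>0\<bar> = \<bar>\<theta>\<bar> / real (Suc j)" by simp
    also have "\<dots> \<le> \<kappa> / 4" using Suc.prems(2) by (simp add: divide_le_eq mult.commute)
    finally have diff: "\<bar>\<theta> - \<theta>0\<bar> \<le> \<kappa> / 4" .
    define u v where "u = x * cis \<theta>0" and "v = x * cis \<theta>"
    have IH: "u \<in> comp_at x" "(3/16) ^ j \<le> 1 - (norm (\<phi> u))\<^sup>2"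
      "norm (f u - s) \<le> \<epsilon> / distortion_const ^ (N - j)"
      using Suc.IH[of \<theta>0] Suc.prems(1) \<theta>0 by (auto simp: u_def)
    have nu: "norm u = norm x" by (simp add: u_def norm_mult)
    have "ball u \<rho> \<inter> A = {}"
      unfolding \<rho>_def using IH(3) \<epsilon>_le[of "N - j"] by (intro sep nu) linarith
    then have sub: "ball u \<rho> \<subseteq> comp_at x"
      using IH(1) \<rho> by (intro connected_subset_comp_at[of _ u]) auto
    have half: "(3/16) ^ Suc j \<le> 1 - (norm (\<phi> w))\<^sup>2" if "norm (w - u) \<le> \<rho>/2" for w
    proof -
      have "3/16 * (1 - (norm (\<phi> u))\<^sup>2) \<le> 1 - (norm (\<phi> w))\<^sup>2"
        by (rule Schwarz_Pick_half[OF holomorphic_on_subset[OF \<phi>(1) sub] \<rho> _ that])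
          (use \<phi>(2) sub in force)
      then show ?thesis using IH(2) by simp
    qed
    have "v - u = x * (cis \<theta> - cis \<theta>0)" by (simp add: u_def v_def algebra_simps)
    then have "norm (v - u) = norm x * norm (cis \<theta> - cis \<theta>0)" by (simp add: norm_mult)
    also have "\<dots> \<le> norm x * (\<kappa> / 4)"
      by (intro mult_left_mono order_trans[OF norm_cis_diff_le diff]) simp
    finally have "norm (v - u) \<le> norm x * (\<kappa> / 4)" .
    then have vu: "norm (v - u) \<le> \<rho> / 4" by (simp add: \<rho>_def ac_simps)
    \<comment> \<open>Schwarz-Pick on the half disc keeps \<open>\<phi>\<close> in the range where
      \<open>good\<close> applies; \<open>v\<close> lies within half of this smaller radius.\<close>
    have omit: "f ` ball u (\<rho>/2) \<inter> K = {}"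
    proof -
      have "f w \<notin> A" if w: "w \<in> ball u (\<rho>/2)" for w
      proof (rule good)
        have "w \<in> ball u \<rho>" using w \<rho> by simp
        then show "w \<in> comp_at x" using sub by blast
        have "(3/16::real) ^ N \<le> (3/16) ^ Suc j" using Suc.prems(1) by (intro power_decreasing) auto
        also have "\<dots> \<le> 1 - (norm (\<phi> w))\<^sup>2"
          using w by (intro half) (simp add: dist_norm norm_minus_commute)
        finally show "(3/16) ^ N \<le> 1 - (norm (\<phi> w))\<^sup>2" .
      qed
      then show ?thesis using K(4) by blast
    qed
    have "v \<in> cball u (\<rho>/2/2)" using vu by (simp add: dist_norm norm_minus_commute)
    then have "norm (f v - s) \<le> distortion_const * norm (f u - s)"
      using omitted_continuum_distortion(1)[OF holo _ K(1-3) omit] \<rho> by simp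
    also have "\<dots> \<le> distortion_const * (\<epsilon> / distortion_const ^ (N - j))"
      using M IH(3) by (intro mult_left_mono) auto
    also have "N - j = Suc (N - Suc j)" using Suc.prems(1) by simp
    then have "distortion_const * (\<epsilon> / distortion_const ^ (N - j)) = \<epsilon> / distortion_const ^ (N - Suc j)"
      using M by simp
    finally have "norm (f v - s) \<le> \<epsilon> / distortion_const ^ (N - Suc j)" .
    moreover have "v \<in> ball u \<rho>" using vu \<rho> by (simp add: dist_norm norm_minus_commute)
    then have "v \<in> comp_at x" using sub by blast
    moreover have "(3/16) ^ Suc j \<le> 1 - (norm (\<phi> v))\<^sup>2" using vu \<rho> by (intro half) simp
    ultimately show ?case unfolding v_def by blast
  qed
  have nyx: "norm (y / x) = 1" using y x by (simp add: norm_divide)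
  then have "y / x \<noteq> 0" by (metis norm_zero zero_neq_one)
  then have "y / x = cis (Arg (y / x))" using cis_Arg[of "y / x"] nyx by (simp add: sgn_eq)
  then have "y = x * cis (Arg (y / x))" using x(2) by (simp add: field_simps)
  moreover have "\<bar>Arg (y / x)\<bar> \<le> real N * (\<kappa> / 4)"
    using Arg_bounded[of "y / x"] \<kappa>(2) by linarith
  ultimately show ?thesis using claim[of N "Arg (y / x)"] by simp
qed

end

text \<open>Invariance would trap the orbit in \<open>A\<close>, yet at some later time it is large
  and its next point is within \<open>\<epsilon>\<close> of \<open>S\<close>, contrary to
  \<open>far\<close>.\<close>

lemma wandering_domain_orbit_avoids:
  assumes "entire_covering f S" "wandering_domain f W" "w \<in> W"
    and esc: "\<And>B. \<exists>m0. \<forall>m\<ge>m0. \<forall>s\<in>S. norm ((f ^^ m) s) > B"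
    and A: "f ` A \<subseteq> A" and \<epsilon>: "\<epsilon> > 0"
    and far: "\<And>z. z \<in> A \<Longrightarrow> norm z \<ge> R \<Longrightarrow> infdist (f z) S > \<epsilon>"
  shows "(f ^^ n) w \<notin> A"
proof
  assume n: "(f ^^ n) w \<in> A"
  interpret entire_covering f S by fact
  have "(f ^^ (m + n)) w \<in> A" for m
    by (induction m) (use n A in auto)
  then have stay: "(f ^^ m) w \<in> A" if "m \<ge> n" for m
    using that by (metis le_add_diff_inverse2)
  obtain m s where "m \<ge> n" "norm ((f ^^ m) w) \<ge> R" "s \<in> S" "norm ((f ^^ Suc m) w - s) \<le> \<epsilon>"
    using wandering_orbit_returns_near_S[OF assms(2,3) esc \<epsilon>, of n R] by blast
  then show False
    using far[OF stay, of m] infdist_le[of s S "f ((f ^^ m) w)"] by (simp add: dist_norm)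
qed

theorem theorem1p2:
  fixes f :: "complex \<Rightarrow> complex" and A :: "complex set" and \<epsilon> c :: real
  assumes "f \<in> class_B"
    and "((\<lambda>n. INF s\<in>singular_values f. ereal (norm ((f ^^ n) s))) \<longlongrightarrow> \<infinity>) sequentially"
    and "closed A"
    and "singular_values f \<union> f ` A \<subseteq> A"
    and "\<forall>C\<in>components A. \<not> bounded C"
    and "\<epsilon> > 0"
    and "0 < c" and "c < 1"
    and "\<exists>R. \<forall>z\<in>A. norm z \<ge> R \<longrightarrow>
           (\<forall>w. norm (w - z) < c * norm z \<longrightarrow> infdist (f w) (singular_values f) > \<epsilon>)"
  shows "\<not> (\<exists>W. wandering_domain f W)"
proof
  assume "\<exists>W. wandering_domain f W"
  then obtain W where W: "wandering_domain f W" by blast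
  define S where "S = singular_values f"
  have te: "transcendental_entire f" and bS: "bounded S"
    using assms(1) by (auto simp: class_B_def S_def)
  have "continuous_on UNIV f"
    using te by (simp add: transcendental_entire_def holomorphic_on_imp_continuous_on)
  then have ec: "entire_covering f S"
    using te bS singular_values_least[of f] by unfold_locales (auto simp: S_def)
  interpret entire_covering f S by (rule ec)
  have esc: "\<exists>m0. \<forall>m\<ge>m0. \<forall>s\<in>S. norm ((f ^^ m) s) > B" for B
  proof -
    have "eventually (\<lambda>n. ereal B < (INF s\<in>S. ereal (norm ((f ^^ n) s)))) sequentially"
      using assms(2) unfolding S_def tendsto_PInfty by blast
    then obtain m0 where m0: "\<And>m. m \<ge> m0 \<Longrightarrow> ereal B < (INF s\<in>S. ereal (norm ((f ^^ m) s)))"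
      unfolding eventually_sequentially by blast
    have "norm ((f ^^ m) s) > B" if "m \<ge> m0" "s \<in> S" for m s
      using less_INF_D[OF m0[OF that(1)] that(2)] by simp
    then show ?thesis by blast
  qed
  obtain R0 where R0: "\<And>z w. z \<in> A \<Longrightarrow> norm z \<ge> R0 \<Longrightarrow> norm (w - z) < c * norm z \<Longrightarrow> infdist (f w) S > \<epsilon>"
    using assms(9) unfolding S_def by blast
  define R where "R = max R0 1"
  have far: "infdist (f w) S > \<epsilon>" if "z \<in> A" "norm z \<ge> R" "norm (w - z) < c * norm z" for z w
    using R0[OF that(1) _ that(3)] that(2) by (simp add: R_def)
  have far_self: "infdist (f z) S > \<epsilon>" if "z \<in> A" "norm z \<ge> R" for z
  proof (rule far[OF that])
    have "norm z > 0" using that(2) unfolding R_def by linarith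
    then show "norm (z - z) < c * norm z" using assms(7) by simp
  qed
  have SA: "S \<subseteq> A" "f ` A \<subseteq> A" using assms(4) by (auto simp: S_def)
  have comp: "W \<in> components (fatou_set f)" using W by (simp add: wandering_domain_def)
  then obtain z where z: "z \<in> W" using in_components_nonempty by blast
  have "open W" using comp open_fatou_set open_components by blast
  then obtain r where r: "r > 0" "ball z r \<subseteq> W" using z openE by blast
  have avoid: "(f ^^ n) w \<notin> A" if "w \<in> ball z r" for w n
    by (rule wandering_domain_orbit_avoids[OF ec W _ esc SA(2) assms(6) far_self]) (use that r in auto)
  \<comment> \<open>The orbit returns near some point of \<open>S\<close>, so \<open>S\<close> is
    nonempty.\<close>
  have "A \<noteq> {}"
    using wandering_orbit_returns_near_S[OF W z esc assms(6), of 0 0] SA(1) by blast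
  then interpret invariant_unbounded_set f S A
    using assms(3,5) SA by unfold_locales
  \<comment> \<open>A point \<open>a\<close> of \<open>A\<close> within
    \<open>\<kappa> * norm x\<close> of the circle has modulus at least
    \<open>norm x / (1 + c)\<close>, so that distance is at most \<open>c * norm a\<close>.\<close>
  define \<kappa> where "\<kappa> = c / (1 + c)"
  have \<kappa>: "\<kappa> > 0" using assms(7) by (simp add: \<kappa>_def)
  obtain N :: nat where N: "pi / (\<kappa> / 4) \<le> real N" using real_arch_simple by blast
  then have N: "pi \<le> real N * (\<kappa> / 4)" using \<kappa> by (simp add: field_simps)
  have q: "0 < (3/16 :: real) ^ N" "(3/16 :: real) ^ N \<le> 1" by (auto intro: power_le_one)
  \<comment> \<open>\<open>norm (\<phi> y) \<le> t\<close> expresses the Schwarz-Pick bound left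
    after \<open>N\<close> discs.\<close>
  define t where "t = sqrt (1 - (3/16) ^ N)"
  have t: "0 \<le> t" "t < 1" using q by (auto simp: t_def real_sqrt_lt_1_iff)
  obtain n1 where n1: "\<And>n. n \<ge> n1 \<Longrightarrow> \<exists>\<phi>. \<phi> holomorphic_on comp_at ((f ^^ n) z) \<and>
    \<phi> ` comp_at ((f ^^ n) z) \<subseteq> ball 0 1 \<and> \<phi> ((f ^^ n) z) = 0 \<and>
    (\<forall>y\<in>comp_at ((f ^^ n) z). norm (\<phi> y) \<le> t \<longrightarrow> f y \<notin> A)"
    using orbit_asymptotically_isometric[OF r(1) avoid t] by blast
  obtain b0 where b0: "b0 > 0" "S \<subseteq> ball 0 b0" using bounded_subset_ballD[OF bS, of 0] by blast
  have "\<not> bounded (range f)" using Liouville_theorem[OF holo] not_constant by blast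
  then obtain y0 where y0: "norm (f y0) > b0 + \<epsilon>" by (metis bounded_iff not_le rangeE)
  have "\<epsilon> / distortion_const ^ N > 0" using assms(6) distortion_const_gt_1 by simp
  \<comment> \<open>The tolerance pays for \<open>N\<close> factors of
    \<open>distortion_const\<close>; the size puts \<open>y0\<close> inside the circle and nearby
    points of \<open>A\<close> beyond \<open>R\<close>.\<close>
  from wandering_orbit_returns_near_S[OF W z esc this, of n1 "max (R * (1 + c)) (norm y0)"]
  obtain n s where n: "n \<ge> n1" "norm ((f ^^ n) z) \<ge> max (R * (1 + c)) (norm y0)"
    and s: "s \<in> S" "norm ((f ^^ Suc n) z - s) \<le> \<epsilon> / distortion_const ^ N" by blast
  define x where "x = (f ^^ n) z"
  have xR: "norm x \<ge> R * (1 + c)" "norm x \<ge> norm y0" using n(2) by (auto simp: x_def)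
  have xA: "x \<notin> A" using avoid[of z n] r(1) by (simp add: x_def)
  have x0: "x \<noteq> 0" using xR(1) assms(7) by (auto simp: R_def mult_le_0_iff)
  obtain \<phi> where \<phi>: "\<phi> holomorphic_on comp_at x" "\<phi> ` comp_at x \<subseteq> ball 0 1" "\<phi> x = 0"
    "\<And>y. y \<in> comp_at x \<Longrightarrow> norm (\<phi> y) \<le> t \<Longrightarrow> f y \<notin> A"
    using n1[OF n(1)] unfolding x_def by blast
  have bound: "norm (f y - s) \<le> \<epsilon>" if "norm y = norm x" for y
  proof (rule small_on_circle[OF xA x0 \<phi>(1-3) _ s(1) _ \<kappa> N _ that])
    show "f y \<notin> A" if "y \<in> comp_at x" "(3/16) ^ N \<le> 1 - (norm (\<phi> y))\<^sup>2" for y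
      using that by (intro \<phi>(4)) (auto simp: t_def intro: real_le_rsqrt)
    show "norm (f x - s) \<le> \<epsilon> / distortion_const ^ N" using s(2) by (simp add: x_def)
    show "ball y (\<kappa> * norm x) \<inter> A = {}" if y: "norm y = norm x" "norm (f y - s) \<le> \<epsilon>" for y
    proof (rule ccontr)
      assume "ball y (\<kappa> * norm x) \<inter> A \<noteq> {}"
      then obtain a where a: "a \<in> A" "norm (y - a) < \<kappa> * norm x" by (auto simp: dist_norm)
      have "norm a \<ge> norm x - \<kappa> * norm x" using norm_triangle_sub[of y a] a(2) y(1) by simp
      also have "norm x - \<kappa> * norm x = norm x / (1 + c)" using assms(7) by (simp add: \<kappa>_def field_simps)
      finally have na: "norm x / (1 + c) \<le> norm a" .
      have "R \<le> norm x / (1 + c)" using xR(1) assms(7) by (simp add: pos_le_divide_eq)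
      moreover have "\<kappa> * norm x \<le> c * norm a"
        using mult_left_mono[OF na, of c] assms(7) by (simp add: \<kappa>_def)
      ultimately have "infdist (f y) S > \<epsilon>" using a na by (intro far[of a y]) auto
      moreover have "infdist (f y) S \<le> norm (f y - s)" using infdist_le[OF s(1), of "f y"] by (simp add: dist_norm)
      ultimately show False using y(2) by simp
    qed
  qed
  \<comment> \<open>The maximum principle carries the bound on the circle inward to
    \<open>y0\<close>.\<close>
  have "norm (f y0) \<le> b0 + \<epsilon>"
  proof (rule maximum_modulus_frontier[of f "cball 0 (norm x)"])
    fix y :: complex assume "y \<in> frontier (cball 0 (norm x))"
    then have "norm y = norm x" using x0 by (simp add: frontier_cball)
    then have "norm (f y - s) \<le> \<epsilon>" by (rule bound)
    moreover have "norm s < b0" using s(1) b0(2) by auto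
    ultimately show "norm (f y) \<le> b0 + \<epsilon>" using norm_triangle_sub[of "f y" s] by linarith
  qed (use xR(2) holo cont in auto)
  then show False using y0 by simp
qed

end
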